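(* Let $\lambda_1,\lambda_2,c_1,c_2>0$ and $\alpha\in[0,1]$, and let $\{D(t):t\geq 0\}$ be the damped telegraph process with parameters $(\lambda_1,\lambda_2,c_1,c_2,\alpha)$. Then the family of random variables $\left\{\frac{D(t)}{t}:t>0\right\}$ satisfies the large deviation principle on $\mathbb{R}$ (with speed $t$, as $t\to\infty$) with good rate function $I_D:\mathbb{R}\to[0,\infty]$ defined by $$I_D(x):=\begin{cases}\dfrac{|(\lambda_1+\lambda_2)x-(\lambda_2c_1-\lambda_1c_2)|}{c_1+c_2} & \text{if } x\in[-c_2,c_1],\\ \infty & \text{otherwise.}\end{cases}$$
   Context: Damped telegraph process. Fix $\lambda_1,\lambda_2,c_1,c_2>0$ and $\alpha\in[0,1]$. Let $V(0)$ be a random variable with $P(V(0)=c_1)=\alpha$ and $P(V(0)=-c_2)=1-\alpha$. Let $\{\tau_n:n\geq 1\}$ be random variables which are conditionally independent given $V(0)$, with the following conditional distributions: - if $V(0)=c_1$, then for all $k\geq 1$, $\tau_{2k-1}$ is exponentially distributed with mean $\frac{1}{\lambda_1k}$ and $\tau_{2k}$ is exponentially distributed with mean $\frac{1}{\lambda_2k}$; - if $V(0)=-c_2$, then for all $k\geq 1$, $\tau_{2k-1}$ is exponentially distributed with mean $\frac{1}{\lambda_2k}$ and $\tau_{2k}$ is exponentially distributed with mean $\frac{1}{\lambda_1k}$. Set $N(t):=\sum_{n\geq 1}1_{\{\tau_1+\cdots+\tau_n\leq t\}}$ (the number of changes of direction up to time $t$), $$V(t):=\frac{c_1-c_2}{2}+\frac{c_1+c_2}{2}\left(1_{\{V(0)=c_1\}}-1_{\{V(0)=-c_2\}}\right)(-1)^{N(t)},$$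 so that the velocity $V(t)$ alternates between $c_1$ and $-c_2$, starting from $V(0)$ and switching at the times $\tau_1,\ \tau_1+\tau_2,\ \ldots$, and $$D(t):=\int_0^tV(s)\,ds\qquad(t\geq 0).$$ Large deviation principle. A family of real random variables $\{Z(t):t>0\}$ satisfies the large deviation principle with rate function $I$ if: $I:\mathbb{R}\to[0,\infty]$ is lower semi-continuous; $\limsup_{t\to\infty}\frac{1}{t}\log P(Z(t)\in C)\leq-\inf_{x\in C}I(x)$ for all closed sets $C\subset\mathbb{R}$; and $\liminf_{t\to\infty}\frac{1}{t}\log P(Z(t)\in G)\geq-\inf_{x\in G}I(x)$ for all open sets $G\subset\mathbb{R}$. The rate function $I$ is good if all its level sets $\{x\in\mathbb{R}:I(x)\leq\eta\}$, $\eta\geq 0$, are compact. Conventions: $\log 0=-\infty$, $\inf\emptyset=\infty$. *)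

theory Defs
  imports "HOL-Probability.Probability"
begin

section \<open>The damped telegraph process\<close>

text \<open>The parameter of \<^const>\<open>erlang_density\<close> (hence of \<open>exponential_density\<close>) is the rate, so rate
  \<open>a * k\<close> means expectation \<open>1 / (a * k)\<close>. The holding times are indexed from 1; \<open>\<tau> 0\<close> is never used.\<close>

definition damped_holding_times :: "'a measure \<Rightarrow> real \<Rightarrow> real \<Rightarrow> (nat \<Rightarrow> 'a \<Rightarrow> real) \<Rightarrow> bool" where
  "damped_holding_times Q a b \<tau> \<longleftrightarrow>
     prob_space.indep_vars Q (\<lambda>_. borel) \<tau> {1..} \<and>
     (\<forall>k\<ge>1. distributed Q lborel (\<tau> (2 * k - 1)) (exponential_density (a * real k)) \<and>
             distributed Q lborel (\<tau> (2 * k)) (exponential_density (b * real k)))"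

text \<open>Conditioning on the initial velocity is expressed by the conditional measure
  \<open>uniform_measure M A\<close>, that is \<open>P(\<cdot> | A)\<close>; this is meaningful only if \<open>A\<close> has positive
  probability, whence the guards on \<open>\<alpha>\<close> in the last two assumptions.\<close>

locale damped_telegraph = prob_space M for M :: "'a measure" +
  fixes lam1 lam2 c1 c2 \<alpha> :: real
    and V0 :: "'a \<Rightarrow> real"
    and \<tau> :: "nat \<Rightarrow> 'a \<Rightarrow> real"
  assumes V0_measurable: "V0 \<in> borel_measurable M"
    and \<tau>_measurable: "\<And>n. n \<ge> 1 \<Longrightarrow> \<tau> n \<in> borel_measurable M"
    and V0_pos: "measure M {\<omega> \<in> space M. V0 \<omega> = c1} = \<alpha>"
    and V0_neg: "measure M {\<omega> \<in> space M. V0 \<omega> = - c2} = 1 - \<alpha>"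
    and \<tau>_given_pos:
      "\<alpha> > 0 \<Longrightarrow> damped_holding_times (uniform_measure M {\<omega> \<in> space M. V0 \<omega> = c1}) lam1 lam2 \<tau>"
    and \<tau>_given_neg:
      "\<alpha> < 1 \<Longrightarrow> damped_holding_times (uniform_measure M {\<omega> \<in> space M. V0 \<omega> = - c2}) lam2 lam1 \<tau>"

text \<open>The set below is almost surely finite, since the expectations of the holding times have a
  divergent sum; on the exceptional null set \<^const>\<open>card\<close> may return 0.\<close>

definition switch_count :: "(nat \<Rightarrow> 'a \<Rightarrow> real) \<Rightarrow> real \<Rightarrow> 'a \<Rightarrow> nat" where
  "switch_count \<tau> t \<omega> = card {n. n \<ge> 1 \<and> (\<Sum>i=1..n. \<tau> i \<omega>) \<le> t}"

definition telegraph_velocity ::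
  "real \<Rightarrow> real \<Rightarrow> ('a \<Rightarrow> real) \<Rightarrow> (nat \<Rightarrow> 'a \<Rightarrow> real) \<Rightarrow> real \<Rightarrow> 'a \<Rightarrow> real" where
  "telegraph_velocity c1 c2 V0 \<tau> t \<omega> =
     (c1 - c2) / 2 +
     (c1 + c2) / 2 * (of_bool (V0 \<omega> = c1) - of_bool (V0 \<omega> = - c2)) * (- 1) ^ switch_count \<tau> t \<omega>"

definition telegraph_position ::
  "real \<Rightarrow> real \<Rightarrow> ('a \<Rightarrow> real) \<Rightarrow> (nat \<Rightarrow> 'a \<Rightarrow> real) \<Rightarrow> real \<Rightarrow> 'a \<Rightarrow> real" where
  "telegraph_position c1 c2 V0 \<tau> t \<omega> = (LBINT s:{0..t}. telegraph_velocity c1 c2 V0 \<tau> s \<omega>)"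

section \<open>Large deviation principles on the real line\<close>

text \<open>Logarithm of a probability, with \<open>log 0 = -\<infinity>\<close> (the library has \<open>ln 0 = 0\<close>).\<close>

definition log_prob :: "real \<Rightarrow> ereal" where
  "log_prob p = (if p = 0 then - \<infinity> else ereal (ln p))"

definition lower_semicontinuous :: "(real \<Rightarrow> ereal) \<Rightarrow> bool" where
  "lower_semicontinuous I \<longleftrightarrow> (\<forall>x. I x \<le> Liminf (at x) I)"

text \<open>The infimum in \<^typ>\<open>ereal\<close> over the empty set is \<open>\<infinity>\<close>. Measurability is part of the
  definition because \<^const>\<open>measure\<close> vanishes on non-measurable sets.\<close>

definition LDP :: "'a measure \<Rightarrow> (real \<Rightarrow> 'a \<Rightarrow> real) \<Rightarrow> (real \<Rightarrow> ereal) \<Rightarrow> bool" where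
  "LDP M Z I \<longleftrightarrow>
     (\<forall>t>0. Z t \<in> borel_measurable M) \<and>
     (\<forall>x. 0 \<le> I x) \<and>
     lower_semicontinuous I \<and>
     (\<forall>C. closed C \<longrightarrow>
        Limsup at_top (\<lambda>t::real. ereal (1 / t) * log_prob (measure M {\<omega> \<in> space M. Z t \<omega> \<in> C}))
          \<le> - (INF x\<in>C. I x)) \<and>
     (\<forall>G. open G \<longrightarrow>
        Liminf at_top (\<lambda>t::real. ereal (1 / t) * log_prob (measure M {\<omega> \<in> space M. Z t \<omega> \<in> G}))
          \<ge> - (INF x\<in>G. I x))"

definition good_rate :: "(real \<Rightarrow> ereal) \<Rightarrow> bool" where
  "good_rate I \<longleftrightarrow> (\<forall>\<eta>::real. \<eta> \<ge> 0 \<longrightarrow> compact {x. I x \<le> ereal \<eta>})"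

definition damped_rate :: "real \<Rightarrow> real \<Rightarrow> real \<Rightarrow> real \<Rightarrow> real \<Rightarrow> ereal" where
  "damped_rate lam1 lam2 c1 c2 x =
     (if x \<in> {- c2..c1}
      then ereal (\<bar>(lam1 + lam2) * x - (lam2 * c1 - lam1 * c2)\<bar> / (c1 + c2))
      else \<infinity>)"

end

theory Submission
  imports Defs "HOL-Real_Asymp.Real_Asymp"
begin

text \<open>
  Given \<open>V(0) = c1\<close>, let \<open>A\<close> be the time spent moving upwards before \<open>t\<close>, so that
  \<open>D(t) = (c1 + c2) A - c2 t\<close>, and let \<open>U n\<close> and \<open>W n\<close> be the sums of the first \<open>n\<close> holding times
  with odd and with even index. When the time spent moving upwards reaches \<open>u\<close>, the time spent moving
  downwards is \<open>W n\<close>, with \<open>n\<close> determined by \<open>U n \<le> u < U (n + 1)\<close>; hence up to null sets and the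
  boundary case \<open>A = u\<close>, the event \<open>A \<ge> u\<close> is the disjoint union over \<open>n\<close> of the events
  \<open>U n \<le> u < U (n + 1)\<close>, \<open>W n \<le> t - u\<close>. A sum of independent exponential variables with rates
  \<open>l, 2 l, \<dots>, n l\<close> has distribution function \<open>(1 - exp (- l x)) ^ n\<close>, so a geometric series
  gives \<open>P(A \<ge> u) = p / (p + q - p q)\<close> where \<open>p = exp (- lam1 u)\<close> and \<open>q = exp (- lam2 (t - u))\<close>.
  The case \<open>V(0) = - c2\<close> is the mirror image. In both cases the tails of \<open>D(t) / t\<close> are comparable
  to \<open>p / q\<close> and \<open>q / p\<close>, that is to \<open>exp (- t I(x))\<close>, and a rate function which is monotone on each
  side of its zero is determined by the tails.
\<close>

section \<open>The time spent in the initial direction\<close>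

lemma card_partial_sums_le:
  fixes x :: "nat \<Rightarrow> real"
  assumes pos: "\<And>i. 1 \<le> i \<Longrightarrow> 0 < x i"
    and "(\<Sum>i=1..m. x i) \<le> s" "s < (\<Sum>i=1..Suc m. x i)"
  shows "card {n. n \<ge> 1 \<and> (\<Sum>i=1..n. x i) \<le> s} = m"
proof -
  have mono: "(\<Sum>i=1..n. x i) \<le> (\<Sum>i=1..k. x i)" if "n \<le> k" for n k
    using that pos by (intro sum_mono2) (auto intro: less_imp_le)
  have "{n. n \<ge> 1 \<and> (\<Sum>i=1..n. x i) \<le> s} = {1..m}"
  proof (intro equalityI subsetI)
    fix n assume "n \<in> {n. n \<ge> 1 \<and> (\<Sum>i=1..n. x i) \<le> s}"
    then show "n \<in> {1..m}"
      using assms(3) mono[of "Suc m" n] by (cases "n \<le> m") auto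
  next
    fix n assume "n \<in> {1..m}"
    then show "n \<in> {n. n \<ge> 1 \<and> (\<Sum>i=1..n. x i) \<le> s}"
      using assms(2) mono[of n m] by auto
  qed
  then show ?thesis by simp
qed

lemma sum_odd_even_split:
  fixes x :: "nat \<Rightarrow> real"
  shows "(\<Sum>i=1..2*n. x i) = (\<Sum>k=1..n. x (2*k-1)) + (\<Sum>k=1..n. x (2*k))"
  by (induction n) (auto simp: numeral_2_eq_2)

text \<open>The endpoints carry no hypothesis because \<open>switch_count\<close> jumps there; two
  points do not change the integral.\<close>

lemma has_integral_const_on_open_interval:
  fixes f :: "real \<Rightarrow> real"
  assumes "a \<le> b" "\<And>s. a < s \<Longrightarrow> s < b \<Longrightarrow> f s = c"
  shows "(f has_integral c * (b - a)) {a..b}"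
proof (rule has_integral_spike_finite[where S = "{a, b}"])
  show "((\<lambda>_. c) has_integral c * (b - a)) {a..b}"
    using has_integral_const_real[of c a b] assms(1) by (simp add: mult.commute)
qed (use assms(2) in auto)

text \<open>The velocity has its initial value exactly while the count is even. At time
  \<open>u + W n\<close> exactly \<open>n\<close> phases with odd count are complete, of total
  length \<open>W n\<close>, so the rest, of length \<open>u\<close>, was spent with even
  count.\<close>

lemma has_integral_even_switch_count:
  fixes \<tau> :: "nat \<Rightarrow> 'a \<Rightarrow> real"
  assumes pos: "\<And>i. 1 \<le> i \<Longrightarrow> 0 < \<tau> i \<omega>"
    and u: "(\<Sum>k=1..n. \<tau> (2*k-1) \<omega>) \<le> u" "u \<le> (\<Sum>k=1..Suc n. \<tau> (2*k-1) \<omega>)"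
  shows "((\<lambda>s. of_bool (even (switch_count \<tau> s \<omega>)) :: real) has_integral u)
           {0..u + (\<Sum>k=1..n. \<tau> (2*k) \<omega>)}"
proof -
  define f :: "real \<Rightarrow> real" where "f s = of_bool (even (switch_count \<tau> s \<omega>))" for s
  define U where "U n = (\<Sum>k=1..n. \<tau> (2*k-1) \<omega>)" for n
  define W where "W n = (\<Sum>k=1..n. \<tau> (2*k) \<omega>)" for n
  have even_sum: "(\<Sum>i=1..2*n. \<tau> i \<omega>) = U n + W n" for n
    unfolding U_def W_def by (rule sum_odd_even_split)
  have USuc: "U (Suc n) = U n + \<tau> (2*n+1) \<omega>" and WSuc: "W (Suc n) = W n + \<tau> (2*n+2) \<omega>" for n
    by (simp_all add: U_def W_def)
  have odd_sum: "(\<Sum>i=1..Suc (2*n). \<tau> i \<omega>) = U (Suc n) + W n" for n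
    using even_sum[of n] by (simp add: USuc)
  have even_sum': "(\<Sum>i=1..Suc (Suc (2*n)). \<tau> i \<omega>) = U (Suc n) + W (Suc n)" for n
    using even_sum[of "Suc n"] by simp
  have one: "f s = 1" if "U n + W n \<le> s" "s < U (Suc n) + W n" for s n
  proof -
    have "switch_count \<tau> s \<omega> = 2 * n"
      unfolding switch_count_def
      by (rule card_partial_sums_le) (use pos that even_sum odd_sum in \<open>simp_all del: sum.cl_ivl_Suc\<close>)
    then show ?thesis by (simp add: f_def)
  qed
  have zero: "f s = 0" if "U (Suc n) + W n \<le> s" "s < U (Suc n) + W (Suc n)" for s n
  proof -
    have "switch_count \<tau> s \<omega> = Suc (2 * n)"
      unfolding switch_count_def
      by (rule card_partial_sums_le) (use pos that even_sum' odd_sum in \<open>simp_all del: sum.cl_ivl_Suc\<close>)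
    then show ?thesis by (simp add: f_def)
  qed
  have U0: "0 \<le> U n" and W0: "0 \<le> W n" for n
    unfolding U_def W_def by (auto intro!: sum_nonneg less_imp_le[OF pos])
  have Ule: "U n \<le> U (Suc n)" and Wle: "W n \<le> W (Suc n)" for n
    using pos[of "2*n+1"] pos[of "2*n+2"] by (simp_all add: USuc WSuc)
  \<comment> \<open>Crosses part of the next even phase; \<open>v = U (Suc n)\<close> serves the
    induction, \<open>v = u\<close> the conclusion.\<close>
  have up: "(f has_integral v) {0..v + W n}"
    if "(f has_integral U n) {0..U n + W n}" "U n \<le> v" "v \<le> U (Suc n)" for v n
  proof -
    have "(f has_integral 1 * ((v + W n) - (U n + W n))) {U n + W n..v + W n}"
      using that(2,3) by (intro has_integral_const_on_open_interval one[where n = n]) auto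
    from has_integral_combine[OF _ _ that(1) this] U0[of n] W0[of n] that(2)
    show ?thesis by simp
  qed
  have "(f has_integral U n) {0..U n + W n}" for n
  proof (induction n)
    case 0
    then show ?case by (simp add: U_def W_def has_integral_refl)
  next
    case (Suc n)
    have 1: "(f has_integral U (Suc n)) {0..U (Suc n) + W n}"
      using up[OF Suc] Ule by simp
    have "(f has_integral 0 * ((U (Suc n) + W (Suc n)) - (U (Suc n) + W n)))
        {U (Suc n) + W n..U (Suc n) + W (Suc n)}"
      using Wle[of n] by (intro has_integral_const_on_open_interval zero[where n = n]) auto
    from has_integral_combine[OF _ _ 1 this] U0[of "Suc n"] W0[of n] Wle[of n]
    show ?case by simp
  qed
  from up[OF this, of n u] u show ?thesis
    by (simp add: f_def[abs_def] U_def W_def)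
qed

text \<open>Time is counted relative to the initial direction, so that one analysis serves both
  values of \<open>V0\<close>.\<close>

definition even_time :: "(nat \<Rightarrow> 'a \<Rightarrow> real) \<Rightarrow> real \<Rightarrow> 'a \<Rightarrow> real" where
  "even_time \<tau> t \<omega> = (LBINT s:{0..t}. of_bool (even (switch_count \<tau> s \<omega>)))"

section \<open>Measurability, monotonicity and range of the occupation time\<close>

lemma measurable_switch_count_pair:
  assumes "\<And>n. n \<ge> 1 \<Longrightarrow> \<tau> n \<in> borel_measurable N"
  shows "(\<lambda>(\<omega>, s). switch_count \<tau> s \<omega>) \<in> measurable (N \<Otimes>\<^sub>M lborel) (count_space UNIV)"
proof -
  have "(\<lambda>x. card {n. n \<ge> 1 \<and> (\<Sum>i=1..n. \<tau> i (fst x)) \<le> snd x})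
    \<in> measurable (N \<Otimes>\<^sub>M lborel) (count_space UNIV)"
  proof (rule measurable_card)
    fix n :: nat
    have "(\<lambda>\<omega>. \<Sum>i=1..n. \<tau> i \<omega>) \<in> borel_measurable N"
      by (intro borel_measurable_sum assms) simp
    from measurable_compose[OF measurable_fst this]
    have [measurable]: "(\<lambda>x. \<Sum>i=1..n. \<tau> i (fst x)) \<in> borel_measurable (N \<Otimes>\<^sub>M lborel)" .
    show "{x \<in> space (N \<Otimes>\<^sub>M lborel). n \<in> {n. n \<ge> 1 \<and> (\<Sum>i=1..n. \<tau> i (fst x)) \<le> snd x}}
        \<in> sets (N \<Otimes>\<^sub>M lborel)"
      unfolding mem_Collect_eq by measurable
  qed
  then show ?thesis
    unfolding switch_count_def case_prod_unfold .
qed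

lemma measurable_switch_count:
  assumes "\<omega> \<in> space N" "\<And>n. n \<ge> 1 \<Longrightarrow> \<tau> n \<in> borel_measurable N"
  shows "(\<lambda>s. switch_count \<tau> s \<omega>) \<in> measurable lborel (count_space UNIV)"
proof -
  have "(\<lambda>s. (\<lambda>(\<omega>, s). switch_count \<tau> s \<omega>) (\<omega>, s)) \<in> measurable lborel (count_space UNIV)"
    by (rule measurable_compose[OF measurable_Pair1'[OF assms(1)] measurable_switch_count_pair[OF assms(2)]])
  then show ?thesis by (simp only: prod.case)
qed

lemma set_integrable_even_switch_count:
  assumes "\<omega> \<in> space N" "\<And>n. n \<ge> 1 \<Longrightarrow> \<tau> n \<in> borel_measurable N"
  shows "set_integrable lborel {0..t} (\<lambda>s. of_bool (even (switch_count \<tau> s \<omega>)) :: real)"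
proof (rule set_integrable_bound[where f = "\<lambda>_. 1 :: real"])
  note [measurable] = measurable_switch_count[OF assms]
  show "set_integrable lborel {0..t} (\<lambda>_. 1 :: real)"
    by (intro borel_integrable_atLeastAtMost') simp
  show "set_borel_measurable lborel {0..t} (\<lambda>s. of_bool (even (switch_count \<tau> s \<omega>)) :: real)"
    unfolding set_borel_measurable_def by measurable
qed auto

text \<open>An integral over \<open>s\<close> is measurable in the parameter once the integrand is
  jointly measurable, hence \<open>measurable_switch_count_pair\<close>.\<close>

lemma even_time_measurable:
  assumes [measurable]: "\<And>n. n \<ge> 1 \<Longrightarrow> \<tau> n \<in> borel_measurable N"
  shows "even_time \<tau> t \<in> borel_measurable N"
proof -
  note [measurable] = measurable_switch_count_pair[OF assms]
  have "(\<lambda>(\<omega>, s). indicator {0..t} s *\<^sub>R (of_bool (even (switch_count \<tau> s \<omega>)) :: real))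
      \<in> borel_measurable (N \<Otimes>\<^sub>M lborel)"
    by measurable
  then show ?thesis
    unfolding even_time_def[abs_def] set_lebesgue_integral_def
    by (rule lborel.borel_measurable_lebesgue_integral)
qed

lemma even_time_mono:
  assumes "\<omega> \<in> space N" "\<And>n. n \<ge> 1 \<Longrightarrow> \<tau> n \<in> borel_measurable N" "s \<le> t"
  shows "even_time \<tau> s \<omega> \<le> even_time \<tau> t \<omega>"
  unfolding even_time_def set_lebesgue_integral_def
  using assms(3) set_integrable_even_switch_count[OF assms(1,2)]
  by (intro integral_mono) (auto simp: set_integrable_def split: split_indicator)

lemma even_time_bounds:
  assumes "\<omega> \<in> space N" "\<And>n. n \<ge> 1 \<Longrightarrow> \<tau> n \<in> borel_measurable N" "0 \<le> t"
  shows "0 \<le> even_time \<tau> t \<omega>" "even_time \<tau> t \<omega> \<le> t"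
proof -
  show "0 \<le> even_time \<tau> t \<omega>"
    unfolding even_time_def set_lebesgue_integral_def
    by (intro Bochner_Integration.integral_nonneg) auto
  have "even_time \<tau> t \<omega> \<le> (LBINT s:{0..t}. 1)"
    unfolding even_time_def
    by (intro set_integral_mono set_integrable_even_switch_count[OF assms(1,2)])
       (auto intro: borel_integrable_atLeastAtMost')
  also have "\<dots> = t"
    using assms(3) by (simp add: set_lebesgue_integral_def)
  finally show "even_time \<tau> t \<omega> \<le> t" .
qed

text \<open>Exhibits a time at which the occupation time equals \<open>u\<close>. As
  \<open>even_time\<close> is monotone in time, comparing its value at \<open>t\<close> with
  \<open>u\<close> then reduces to comparing \<open>t\<close> with \<open>u + W n\<close>.\<close>

lemma even_time_eq:
  assumes "\<omega> \<in> space N" "\<And>n. n \<ge> 1 \<Longrightarrow> \<tau> n \<in> borel_measurable N"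
    and "\<And>i. 1 \<le> i \<Longrightarrow> 0 < \<tau> i \<omega>"
    and "(\<Sum>k=1..n. \<tau> (2*k-1) \<omega>) \<le> u" "u \<le> (\<Sum>k=1..Suc n. \<tau> (2*k-1) \<omega>)"
  shows "even_time \<tau> (u + (\<Sum>k=1..n. \<tau> (2*k) \<omega>)) \<omega> = u"
  unfolding even_time_def
  by (rule trans[OF set_borel_integral_eq_integral(2) integral_unique])
     (rule set_integrable_even_switch_count[OF assms(1,2)], assumption,
      rule has_integral_even_switch_count[where \<tau> = \<tau> and \<omega> = \<omega>, OF assms(3-5)])

text \<open>Rests on \<open>(- 1) ^ N = 2 * of_bool (even N) - 1\<close>. The sign \<open>d\<close>
  is kept general, so the identity also covers paths on which \<open>V0\<close> is neither
  \<open>c1\<close> nor \<open>- c2\<close>.\<close>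

lemma telegraph_position_eq:
  fixes V0 :: "'a \<Rightarrow> real" and c1 c2 :: real
  assumes "\<omega> \<in> space N" "\<And>n. n \<ge> 1 \<Longrightarrow> \<tau> n \<in> borel_measurable N" "0 \<le> t"
  defines "d :: real \<equiv> of_bool (V0 \<omega> = c1) - of_bool (V0 \<omega> = - c2)"
  shows "telegraph_position c1 c2 V0 \<tau> t \<omega> =
    t * ((c1 - c2) / 2) + (c1 + c2) / 2 * d * (2 * even_time \<tau> t \<omega> - t)"
proof -
  have *: "telegraph_velocity c1 c2 V0 \<tau> s \<omega> =
      ((c1 - c2) / 2 - (c1 + c2) / 2 * d) +
        ((c1 + c2) * d) * of_bool (even (switch_count \<tau> s \<omega>))" for s
    by (simp add: telegraph_velocity_def d_def)
  have "telegraph_position c1 c2 V0 \<tau> t \<omega> =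
    (LBINT s:{0..t}. (c1 - c2) / 2 - (c1 + c2) / 2 * d) +
      (LBINT s:{0..t}. ((c1 + c2) * d) * of_bool (even (switch_count \<tau> s \<omega>)))"
    unfolding telegraph_position_def *
    using set_integrable_even_switch_count[OF assms(1,2)]
    by (intro set_integral_add set_integrable_mult_right) (auto intro: borel_integrable_atLeastAtMost')
  also have "\<dots> = t * ((c1 - c2) / 2 - (c1 + c2) / 2 * d) + ((c1 + c2) * d) * even_time \<tau> t \<omega>"
    using assms(3) by (simp add: even_time_def) (simp add: set_lebesgue_integral_def)
  also have "\<dots> = t * ((c1 - c2) / 2) + (c1 + c2) / 2 * d * (2 * even_time \<tau> t \<omega> - t)"
    by (simp add: field_simps)
  finally show ?thesis .
qed

section \<open>Sums of exponential variables with linearly growing rates\<close>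

lemma (in prob_space) AE_exponential_pos:
  assumes "distributed M lborel X (exponential_density l)"
  shows "AE \<omega> in M. 0 < X \<omega>"
proof -
  \<comment> \<open>The density need not vanish at 0; that point is discarded as a Lebesgue null
    set.\<close>
  have "AE x in lborel. 0 < ennreal (exponential_density l x) \<longrightarrow> 0 < x"
    using AE_lborel_singleton[of "0 :: real"]
    by eventually_elim (auto simp: exponential_density_def split: if_splits)
  then show ?thesis
    by (subst distributed_AE2[OF assms]) auto
qed

text \<open>The density times the distribution function at \<open>x - y\<close> is the derivative of
  \<open>y \<mapsto> - (exp (- l * y) - exp (- l * x)) ^ Suc n\<close>.\<close>

lemma nn_integral_exponential_density_times_power:
  fixes l x :: real
  assumes "0 < l" "0 \<le> x"
  shows "(\<integral>\<^sup>+y. ennreal (exponential_density (l * real (Suc n)) y) *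
      (ennreal ((1 - exp (- l * (x - y))) ^ n) * indicator {..x} y) \<partial>lborel) =
    ennreal ((1 - exp (- l * x)) ^ Suc n)"
proof -
  define g where "g y = real (Suc n) * l * exp (- l * y) * (exp (- l * y) - exp (- l * x)) ^ n" for y
  have "(\<integral>\<^sup>+y. ennreal (exponential_density (l * real (Suc n)) y) *
      (ennreal ((1 - exp (- l * (x - y))) ^ n) * indicator {..x} y) \<partial>lborel) =
    (\<integral>\<^sup>+y. ennreal (g y) * indicator {0..x} y \<partial>lborel)"
  proof (intro nn_integral_cong)
    fix y :: real
    have "exponential_density (l * real (Suc n)) y * (1 - exp (- l * (x - y))) ^ n = g y"
      if "0 \<le> y"
    proof -
      have 1: "exp (- y * (l * real (Suc n))) = exp (- l * y) * exp (- l * y) ^ n"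
        by (simp add: exp_of_nat_mult[symmetric] exp_add[symmetric] algebra_simps)
      have 2: "exp (- l * y) * (1 - exp (- l * (x - y))) = exp (- l * y) - exp (- l * x)"
        by (simp add: algebra_simps exp_add[symmetric])
      have "exponential_density (l * real (Suc n)) y * (1 - exp (- l * (x - y))) ^ n =
          l * real (Suc n) * exp (- l * y) * (exp (- l * y) * (1 - exp (- l * (x - y)))) ^ n"
        using that unfolding exponential_density_def 1 by (simp add: power_mult_distrib)
      then show ?thesis
        unfolding 2 g_def by simp
    qed
    moreover have "0 \<le> exponential_density (l * real (Suc n)) y"
      using assms by (intro erlang_density_nonneg) simp
    ultimately show "ennreal (exponential_density (l * real (Suc n)) y) *
        (ennreal ((1 - exp (- l * (x - y))) ^ n) * indicator {..x} y) =
        ennreal (g y) * indicator {0..x} y"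
      using assms
      by (auto simp: ennreal_mult'[symmetric] exponential_density_def[of _ y] split: split_indicator)
  qed
  also have "\<dots> = ennreal (- ((exp (- l * x) - exp (- l * x)) ^ Suc n) - - ((exp (- l * 0) - exp (- l * x)) ^ Suc n))"
  proof (rule nn_integral_FTC_Icc)
    show "g \<in> borel_measurable borel"
      unfolding g_def by measurable
    fix y assume y: "y \<in> {0..x}"
    show "((\<lambda>y. - ((exp (- l * y) - exp (- l * x)) ^ Suc n)) has_real_derivative g y) (at y)"
      unfolding g_def
      by (auto intro!: derivative_eq_intros simp: algebra_simps simp del: power_Suc)
    show "0 \<le> g y"
      using y assms by (auto simp: g_def intro!: mult_nonneg_nonneg)
  qed fact
  finally show ?thesis by simp
qed

text \<open>The right side is the distribution function of the maximum of \<open>n\<close>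
  independent exponential variables of rate \<open>l\<close>, whose spacings are exponential with
  rates \<open>l * k\<close>. The proof is an induction by convolution with the last
  summand.\<close>

lemma (in prob_space) prob_sum_exponential_le:
  fixes X :: "nat \<Rightarrow> 'a \<Rightarrow> real"
  assumes l: "0 < l"
    and indep: "indep_vars (\<lambda>_. borel) X {1..}"
    and distr: "\<And>k. 1 \<le> k \<Longrightarrow> distributed M lborel (X k) (exponential_density (l * real k))"
    and x: "0 \<le> x"
  shows "prob {\<omega> \<in> space M. (\<Sum>k=1..n. X k \<omega>) \<le> x} = (1 - exp (- l * x)) ^ n"
  using x
proof (induction n arbitrary: x)
  case 0
  then show ?case by (simp add: prob_space)
next
  case (Suc n)
  define Y where "Y = X (Suc n)"
  define U where "U \<omega> = (\<Sum>k=1..n. X k \<omega>)" for \<omega>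
  have [measurable]: "X k \<in> borel_measurable M" if "1 \<le> k" for k
    using distributed_measurable[OF distr[OF that]] by simp
  have U [measurable]: "U \<in> borel_measurable M" and Y [measurable]: "Y \<in> borel_measurable M"
    unfolding U_def Y_def by (auto intro!: borel_measurable_sum)
  have ind: "indep_var borel Y borel U"
    unfolding Y_def U_def
    by (intro indep_vars_sum indep_vars_subset[OF indep]) auto
  \<comment> \<open>The induction hypothesis needs \<open>x - y\<close> to be nonnegative; for
    \<open>y > x\<close> the event is null, since almost surely \<open>U\<close> is a sum of
    positive terms. Hence the indicator.\<close>
  have U_le: "emeasure (distr M borel U) {u. y + u \<le> x} =
      ennreal ((1 - exp (- l * (x - y))) ^ n) * indicator {..x} y" for y
  proof -
    have "{u. y + u \<le> x} = {..x - y}" by auto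
    then have "emeasure (distr M borel U) {u. y + u \<le> x} = emeasure M {\<omega> \<in> space M. U \<omega> \<le> x - y}"
      by (subst emeasure_distr) (auto intro!: arg_cong[where f = "emeasure M"])
    also have "\<dots> = ennreal ((1 - exp (- l * (x - y))) ^ n) * indicator {..x} y"
    proof (cases "y \<le> x")
      case True
      then show ?thesis
        using Suc.IH[of "x - y"] by (simp add: emeasure_eq_measure U_def)
    next
      case False
      have "AE \<omega> in M. \<forall>k\<in>{1..n}. 0 < X k \<omega>"
        by (intro AE_finite_allI) (auto intro!: AE_exponential_pos[OF distr])
      then have "AE \<omega> in M. \<not> U \<omega> \<le> x - y"
      proof eventually_elim
        case (elim \<omega>)
        then have "0 \<le> U \<omega>"
          unfolding U_def by (intro sum_nonneg) (auto intro: less_imp_le)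
        then show ?case using False by simp
      qed
      then have "emeasure M {\<omega> \<in> space M. U \<omega> \<le> x - y} = 0"
        by (subst AE_iff_measurable[symmetric, where P = "\<lambda>\<omega>. \<not> U \<omega> \<le> x - y"]) auto
      then show ?thesis using False by simp
    qed
    finally show ?thesis .
  qed
  have halfplane: "{p :: real \<times> real. fst p + snd p \<le> x} \<in> sets (borel \<Otimes>\<^sub>M borel)"
    unfolding borel_prod by (intro borel_closed closed_Collect_le continuous_intros)
  \<comment> \<open>By independence the joint law of \<open>Y\<close> and \<open>U\<close> is a
    product, so the half-plane is measured by integrating its sections, which \<open>U_le\<close>
    evaluates.\<close>
  have "{\<omega> \<in> space M. (\<Sum>k=1..Suc n. X k \<omega>) \<le> x} =
      (\<lambda>\<omega>. (Y \<omega>, U \<omega>)) -` {p. fst p + snd p \<le> x} \<inter> space M"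
    by (auto simp: Y_def U_def algebra_simps)
  then have "emeasure M {\<omega> \<in> space M. (\<Sum>k=1..Suc n. X k \<omega>) \<le> x} =
      emeasure (distr M (borel \<Otimes>\<^sub>M borel) (\<lambda>\<omega>. (Y \<omega>, U \<omega>))) {p. fst p + snd p \<le> x}"
    using halfplane by (subst emeasure_distr) simp_all
  also have "distr M (borel \<Otimes>\<^sub>M borel) (\<lambda>\<omega>. (Y \<omega>, U \<omega>)) = distr M borel Y \<Otimes>\<^sub>M distr M borel U"
    using ind unfolding indep_var_distribution_eq by simp
  also have "emeasure \<dots> {p. fst p + snd p \<le> x} =
      (\<integral>\<^sup>+y. emeasure (distr M borel U) (Pair y -` {p. fst p + snd p \<le> x}) \<partial>distr M borel Y)"
  proof -
    interpret D: prob_space "distr M borel U" by (rule prob_space_distr) (rule U)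
    show ?thesis
      using halfplane
      by (intro D.emeasure_pair_measure_alt) (simp cong: sets_pair_measure_cong)
  qed
  also have "distr M borel Y = density lborel (exponential_density (l * real (Suc n)))"
    using distributed_distr_eq_density[OF distr[of "Suc n"]]
    by (simp add: Y_def cong: distr_cong)
  also have "(\<integral>\<^sup>+y. emeasure (distr M borel U) (Pair y -` {p. fst p + snd p \<le> x})
        \<partial>density lborel (exponential_density (l * real (Suc n)))) =
      (\<integral>\<^sup>+y. ennreal (exponential_density (l * real (Suc n)) y) *
        (ennreal ((1 - exp (- l * (x - y))) ^ n) * indicator {..x} y) \<partial>lborel)"
    by (subst nn_integral_density) (simp_all add: vimage_def U_le)
  also have "\<dots> = ennreal ((1 - exp (- l * x)) ^ Suc n)"
    by (rule nn_integral_exponential_density_times_power) fact+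
  finally show ?case
    using l Suc.prems by (simp add: emeasure_eq_measure del: power_Suc sum.cl_ivl_Suc)
qed

section \<open>Tails of the time spent in the initial direction\<close>

text \<open>Injectivity makes the index blocks \<open>{f j}\<close> disjoint; restrictions to
  disjoint blocks are independent, and each is then evaluated at its only index.\<close>

lemma (in prob_space) indep_vars_reindex_inj:
  assumes "indep_vars (\<lambda>_. N) X I" "inj_on f J" "f ` J \<subseteq> I"
  shows "indep_vars (\<lambda>_. N) (\<lambda>j. X (f j)) J"
proof -
  have "indep_vars (\<lambda>j. PiM {f j} (\<lambda>_. N)) (\<lambda>j \<omega>. restrict (\<lambda>i. X i \<omega>) {f j}) J"
    using assms(2,3)
    by (intro indep_vars_restrict[OF assms(1)])
       (auto simp: disjoint_family_on_def inj_on_def)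
  from indep_vars_compose2[OF this, of "\<lambda>j g. g (f j)" "\<lambda>_. N"]
  show ?thesis by simp
qed

text \<open>Let K and L count the odd holding times that fit into \<open>u\<close> and the even ones
  that fit into \<open>t - u\<close>. They are independent and geometric with parameters
  \<open>p\<close> and \<open>q\<close>, and \<open>p / (p + q - p * q)\<close> is the probability
  of K <= L. The tie \<open>even_time = u\<close> is left undecided, so this value is bracketed by a
  strict and a non-strict tail.\<close>

lemma (in prob_space) even_time_tail:
  assumes a: "0 < a" and b: "0 < b"
    and holding: "damped_holding_times M a b \<tau>"
    and \<tau> [measurable]: "\<And>n. n \<ge> 1 \<Longrightarrow> \<tau> n \<in> borel_measurable M"
    and u: "0 \<le> u" "u \<le> t"
  defines "p \<equiv> exp (- a * u)" and "q \<equiv> exp (- b * (t - u))"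
  shows "prob {\<omega> \<in> space M. u < even_time \<tau> t \<omega>} \<le> p / (p + q - p * q)"
    and "p / (p + q - p * q) \<le> prob {\<omega> \<in> space M. u \<le> even_time \<tau> t \<omega>}"
proof -
  define U where "U n \<omega> = (\<Sum>k=1..n. \<tau> (2*k-1) \<omega>)" for n \<omega>
  define W where "W n \<omega> = (\<Sum>k=1..n. \<tau> (2*k) \<omega>)" for n \<omega>
  define B where "B n = {\<omega> \<in> space M. U n \<omega> \<le> u \<and> u < U (Suc n) \<omega> \<and> W n \<omega> \<le> t - u}" for n
  have indep: "indep_vars (\<lambda>_. borel) \<tau> {1..}"
    and odd: "\<And>k. 1 \<le> k \<Longrightarrow> distributed M lborel (\<tau> (2*k-1)) (exponential_density (a * real k))"
    and even: "\<And>k. 1 \<le> k \<Longrightarrow> distributed M lborel (\<tau> (2*k)) (exponential_density (b * real k))"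
    using holding by (auto simp: damped_holding_times_def)
  have U_meas [measurable]: "U n \<in> borel_measurable M" for n
    unfolding U_def by (intro borel_measurable_sum \<tau>) auto
  have W_meas [measurable]: "W n \<in> borel_measurable M" for n
    unfolding W_def by (intro borel_measurable_sum \<tau>) auto
  have E_meas [measurable]: "even_time \<tau> t \<in> borel_measurable M"
    by (intro even_time_measurable \<tau>)
  have B_meas [measurable]: "B n \<in> events" for n
    unfolding B_def by measurable
  have U_cdf: "prob {\<omega> \<in> space M. U n \<omega> \<le> x} = (1 - exp (- a * x)) ^ n" if "0 \<le> x" for n x
    unfolding U_def
    by (rule prob_sum_exponential_le[OF a indep_vars_reindex_inj[OF indep] odd that])
       (auto simp: inj_on_def)
  have W_cdf: "prob {\<omega> \<in> space M. W n \<omega> \<le> x} = (1 - exp (- b * x)) ^ n" if "0 \<le> x" for n x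
    unfolding W_def
    by (rule prob_sum_exponential_le[OF b indep_vars_reindex_inj[OF indep] even that])
       (auto simp: inj_on_def)
  have UW: "prob {\<omega> \<in> space M. U m \<omega> \<le> u \<and> W n \<omega> \<le> t - u} = (1 - p) ^ m * (1 - q) ^ n" for m n
  proof -
    \<comment> \<open>Odd and even indices form disjoint blocks, which makes \<open>U m\<close> and
      \<open>W n\<close> independent.\<close>
    define A1 where "A1 = (\<lambda>k. 2*k-1) ` {1..m}"
    define A2 where "A2 = (\<lambda>k. 2*k) ` {1..n}"
    have "A1 \<inter> A2 = {}" "A1 \<subseteq> {1..}" "A2 \<subseteq> {1..}"
      unfolding A1_def A2_def by (auto, presburger)
    from indep_var_restrict[OF indep this]
    have "indep_var borel ((\<lambda>f. \<Sum>k=1..m. f (2*k-1)) \<circ> (\<lambda>\<omega>. restrict (\<lambda>i. \<tau> i \<omega>) A1))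
        borel ((\<lambda>f. \<Sum>k=1..n. f (2*k)) \<circ> (\<lambda>\<omega>. restrict (\<lambda>i. \<tau> i \<omega>) A2))"
      by (rule indep_var_compose)
         (auto intro!: borel_measurable_sum measurable_component_singleton simp: A1_def A2_def)
    also have "(\<lambda>f. \<Sum>k=1..m. f (2*k-1)) \<circ> (\<lambda>\<omega>. restrict (\<lambda>i. \<tau> i \<omega>) A1) = U m"
      by (auto simp: fun_eq_iff U_def A1_def intro!: sum.cong)
    also have "(\<lambda>f. \<Sum>k=1..n. f (2*k)) \<circ> (\<lambda>\<omega>. restrict (\<lambda>i. \<tau> i \<omega>) A2) = W n"
      by (auto simp: fun_eq_iff W_def A2_def intro!: sum.cong)
    finally have "indep_var borel (U m) borel (W n)" .
    from indep_varD[OF this, of "{..u}" "{..t - u}"]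
    have "prob {\<omega> \<in> space M. U m \<omega> \<le> u \<and> W n \<omega> \<le> t - u} =
        prob {\<omega> \<in> space M. U m \<omega> \<le> u} * prob {\<omega> \<in> space M. W n \<omega> \<le> t - u}"
      by (simp add: vimage_def Int_def conj_commute)
    then show ?thesis
      using u U_cdf[of u m] W_cdf[of "t - u" n] by (simp add: p_def q_def)
  qed
  have pq: "0 < p" "p \<le> 1" "0 < q" "q \<le> 1"
    using a b u by (auto simp: p_def q_def)
  have AE_pos: "AE \<omega> in M. \<forall>i\<in>{1..}. 0 < \<tau> i \<omega>"
  proof (rule AE_ball_countable')
    fix i :: nat assume "i \<in> {1..}"
    show "AE \<omega> in M. 0 < \<tau> i \<omega>"
    proof (cases "even i")
      case True
      then obtain k where "i = 2 * k" by blast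
      with \<open>i \<in> {1..}\<close> show ?thesis by (auto intro!: AE_exponential_pos[OF even])
    next
      case False
      then obtain k where "i = 2 * k + 1" using oddE by blast
      with AE_exponential_pos[OF odd[of "Suc k"]] show ?thesis by simp
    qed
  qed auto
  \<comment> \<open>The exceptional event lies in \<open>U n \<le> u\<close> for every
    \<open>n\<close>, so its probability is below every \<open>(1 - p) ^ n\<close>. This supplies
    the crossing index for the upper bound.\<close>
  have AE_unbounded: "AE \<omega> in M. \<exists>n. u < U n \<omega>"
  proof -
    define N where "N = {\<omega> \<in> space M. \<forall>n. U n \<omega> \<le> u}"
    have N_meas [measurable]: "N \<in> events" unfolding N_def by measurable
    have "prob N \<le> (1 - p) ^ n" for n
      using finite_measure_mono[of N "{\<omega> \<in> space M. U n \<omega> \<le> u}"] U_cdf[of u n] u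
      by (auto simp: N_def p_def)
    moreover have "(\<lambda>n. (1 - p) ^ n) \<longlonglongrightarrow> 0"
      using pq by (intro LIMSEQ_power_zero) auto
    ultimately have "prob N \<le> 0"
      by (intro LIMSEQ_le_const) auto
    then have "prob N = 0"
      using measure_nonneg[of M N] by linarith
    then have "AE \<omega> in M. \<omega> \<notin> N"
      by (subst AE_iff_measurable[where N = N]) (auto simp: emeasure_eq_measure N_def)
    then show ?thesis
      using AE_space by eventually_elim (auto simp: N_def not_le)
  qed
  define Good where "Good = {\<omega> \<in> space M. \<forall>i\<in>{1..}. 0 < \<tau> i \<omega>}"
  have Good_meas [measurable]: "Good \<in> events"
  proof -
    have "Good = (\<Inter>i\<in>{1..}. {\<omega> \<in> space M. 0 < \<tau> i \<omega>})"
      by (auto simp: Good_def)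
    also have "\<dots> \<in> events"
      by (intro sets.countable_INT') auto
    finally show ?thesis .
  qed
  have AE_Good: "AE \<omega> in M. \<omega> \<in> Good"
    using AE_pos AE_space by eventually_elim (auto simp: Good_def)
  have U_mono: "U m \<omega> \<le> U n \<omega>" if "\<omega> \<in> Good" "m \<le> n" for m n \<omega>
    unfolding U_def using that
    by (intro sum_mono2) (auto simp: Good_def intro!: less_imp_le)
  \<comment> \<open>On \<open>Good\<close> the sums \<open>U n\<close> are monotone in
    \<open>n\<close>, so the sets \<open>D n\<close> are disjoint everywhere and not only up to null
    sets.\<close>
  define D where "D n = B n \<inter> Good" for n
  have D_prob: "prob (D n) = p * ((1 - p) * (1 - q)) ^ n" for n
  proof -
    have "prob (D n) = prob (B n)"
      unfolding D_def by (intro measure_eq_AE) (use AE_Good in \<open>auto elim: eventually_mono\<close>)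
    \<comment> \<open>Both events have the form treated in \<open>UW\<close>, and the second is
      almost surely contained in the first.\<close>
    also have "\<dots> = prob ({\<omega> \<in> space M. U n \<omega> \<le> u \<and> W n \<omega> \<le> t - u} -
        {\<omega> \<in> space M. U (Suc n) \<omega> \<le> u \<and> W n \<omega> \<le> t - u})"
      by (rule arg_cong[where f = prob]) (auto simp: B_def)
    also have "\<dots> = prob {\<omega> \<in> space M. U n \<omega> \<le> u \<and> W n \<omega> \<le> t - u} -
        prob ({\<omega> \<in> space M. U n \<omega> \<le> u \<and> W n \<omega> \<le> t - u} \<inter>
          {\<omega> \<in> space M. U (Suc n) \<omega> \<le> u \<and> W n \<omega> \<le> t - u})"
      by (rule finite_measure_Diff') auto
    also have "prob ({\<omega> \<in> space M. U n \<omega> \<le> u \<and> W n \<omega> \<le> t - u} \<inter>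
          {\<omega> \<in> space M. U (Suc n) \<omega> \<le> u \<and> W n \<omega> \<le> t - u}) =
        prob {\<omega> \<in> space M. U (Suc n) \<omega> \<le> u \<and> W n \<omega> \<le> t - u}"
    proof (rule measure_eq_AE)
      show "AE \<omega> in M. (\<omega> \<in> {\<omega> \<in> space M. U n \<omega> \<le> u \<and> W n \<omega> \<le> t - u} \<inter>
          {\<omega> \<in> space M. U (Suc n) \<omega> \<le> u \<and> W n \<omega> \<le> t - u}) =
        (\<omega> \<in> {\<omega> \<in> space M. U (Suc n) \<omega> \<le> u \<and> W n \<omega> \<le> t - u})"
        using AE_Good
      proof eventually_elim
        case (elim \<omega>)
        show ?case using U_mono[OF elim, of n "Suc n"] by auto
      qed
    qed auto
    finally show ?thesis
      unfolding UW power_mult_distrib by (simp add: algebra_simps)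
  qed
  have D_disj: "disjoint_family D"
  proof -
    have "m = n" if "\<omega> \<in> D m" "\<omega> \<in> D n" for m n \<omega>
    proof (rule ccontr)
      assume "m \<noteq> n"
      then consider "Suc m \<le> n" | "Suc n \<le> m" by linarith
      then show False
        using that U_mono[of \<omega> "Suc m" n] U_mono[of \<omega> "Suc n" m]
        by cases (auto simp: D_def B_def)
    qed
    then show ?thesis by (auto simp: disjoint_family_on_def)
  qed
  have "(\<lambda>n. prob (D n)) sums prob (\<Union>n. D n)"
    by (rule finite_measure_UNION) (auto simp: D_def D_disj[unfolded D_def])
  moreover have "(\<lambda>n. p * ((1 - p) * (1 - q)) ^ n) sums (p * (1 / (1 - (1 - p) * (1 - q))))"
  proof (intro sums_mult geometric_sums)
    have "0 \<le> (1 - p) * (1 - q)" "(1 - p) * (1 - q) \<le> (1 - p) * 1"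
      using pq by (simp, intro mult_left_mono) auto
    then show "norm ((1 - p) * (1 - q)) < 1" using pq by auto
  qed
  ultimately have "prob (\<Union>n. D n) = p * (1 / (1 - (1 - p) * (1 - q)))"
    unfolding D_prob by (rule sums_unique2)
  also have "1 - (1 - p) * (1 - q) = p + q - p * q"
    by (simp add: algebra_simps)
  finally have D_union: "prob (\<Union>n. D n) = p / (p + q - p * q)"
    by simp
  have D_union_meas [measurable]: "(\<Union>n. D n) \<in> events"
    unfolding D_def by measurable
  have even_time_U: "even_time \<tau> (u + W n \<omega>) \<omega> = u"
    if "\<omega> \<in> Good" "U n \<omega> \<le> u" "u < U (Suc n) \<omega>" for n \<omega>
    unfolding W_def
    by (rule even_time_eq[where N = M]) (use that \<tau> in \<open>auto simp: Good_def U_def\<close>)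
  show "p / (p + q - p * q) \<le> prob {\<omega> \<in> space M. u \<le> even_time \<tau> t \<omega>}"
    unfolding D_union[symmetric]
  proof (rule finite_measure_mono)
    \<comment> \<open>On \<open>D n\<close> the occupation time is \<open>u\<close> already at
      \<open>u + W n \<le> t\<close>; monotonicity does the rest.\<close>
    show "(\<Union>n. D n) \<subseteq> {\<omega> \<in> space M. u \<le> even_time \<tau> t \<omega>}"
    proof
      fix \<omega> assume "\<omega> \<in> (\<Union>n. D n)"
      then obtain n where n: "\<omega> \<in> Good" "U n \<omega> \<le> u" "u < U (Suc n) \<omega>" "u + W n \<omega> \<le> t" "\<omega> \<in> space M"
        by (auto simp: D_def B_def)
      from even_time_mono[where \<tau> = \<tau>, OF n(5) \<tau> n(4)] even_time_U[OF n(1-3)] n(5)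
      show "\<omega> \<in> {\<omega> \<in> space M. u \<le> even_time \<tau> t \<omega>}" by simp
    qed
  qed measurable
  show "prob {\<omega> \<in> space M. u < even_time \<tau> t \<omega>} \<le> p / (p + q - p * q)"
    unfolding D_union[symmetric]
  proof (rule finite_measure_mono_AE)
    show "AE \<omega> in M. \<omega> \<in> {\<omega> \<in> space M. u < even_time \<tau> t \<omega>} \<longrightarrow> \<omega> \<in> (\<Union>n. D n)"
      using AE_Good AE_unbounded
    proof eventually_elim
      case (elim \<omega>)
      show ?case
      proof
        assume *: "\<omega> \<in> {\<omega> \<in> space M. u < even_time \<tau> t \<omega>}"
        \<comment> \<open>First index whose sum exceeds \<open>u\<close>. As \<open>U 0\<close> is
          0, it is a successor, and its predecessor is the required \<open>n\<close>.\<close>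
        define m where "m = (LEAST n. u < U n \<omega>)"
        have m: "u < U m \<omega>"
          unfolding m_def by (rule LeastI_ex) (rule elim)
        moreover have "U 0 \<omega> \<le> u" using u by (simp add: U_def)
        ultimately obtain n where n: "m = Suc n" by (cases m) auto
        have n': "U n \<omega> \<le> u"
          using not_less_Least[of n "\<lambda>n. u < U n \<omega>"] n by (simp add: m_def)
        \<comment> \<open>Otherwise \<open>t\<close> precedes \<open>u + W n\<close>, when the
          occupation time is only \<open>u\<close>, against the strict inequality in
          \<open>*\<close>.\<close>
        have "W n \<omega> \<le> t - u"
        proof (rule ccontr)
          assume "\<not> ?thesis"
          then have "even_time \<tau> t \<omega> \<le> even_time \<tau> (u + W n \<omega>) \<omega>"
            using * \<tau> by (intro even_time_mono[where N = M]) auto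
          then show False
            using * even_time_U[OF elim(1) n'] m n by simp
        qed
        then show "\<omega> \<in> (\<Union>n. D n)"
          using * m n n' elim(1) by (auto simp: D_def B_def)
      qed
    qed
  qed measurable
qed

section \<open>Large deviations from tail estimates\<close>

lemma good_rate_abs_affine:
  fixes x0 m l r :: real
  defines "I \<equiv> \<lambda>x. if x \<in> {l..r} then ereal (m * \<bar>x - x0\<bar>) else \<infinity>"
  shows "good_rate I"
  unfolding good_rate_def
proof (intro allI impI)
  fix \<eta> :: real
  have "{x. I x \<le> ereal \<eta>} = {l..r} \<inter> {x. m * \<bar>x - x0\<bar> \<le> \<eta>}"
    by (auto simp: I_def split: if_splits)
  also have "compact \<dots>"
    by (intro compact_Int_closed closed_Collect_le continuous_intros compact_Icc)
  finally show "compact {x. I x \<le> ereal \<eta>}" .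
qed

lemma lower_semicontinuous_abs_affine:
  fixes x0 m l r :: real
  defines "I \<equiv> \<lambda>x. if x \<in> {l..r} then ereal (m * \<bar>x - x0\<bar>) else \<infinity>"
  shows "lower_semicontinuous I"
  unfolding lower_semicontinuous_def
proof
  fix x :: real
  show "I x \<le> Liminf (at x) I"
  proof (cases "x \<in> {l..r}")
    case True
    \<comment> \<open>This continuous function lies below \<open>I\<close> everywhere and agrees
      with it at \<open>x\<close>.\<close>
    have "((\<lambda>y. ereal (m * \<bar>y - x0\<bar>)) \<longlongrightarrow> ereal (m * \<bar>x - x0\<bar>)) (at x)"
      by (intro tendsto_intros)
    then have "Liminf (at x) (\<lambda>y. ereal (m * \<bar>y - x0\<bar>)) = I x"
      using True by (subst lim_imp_Liminf) (auto simp: I_def)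
    moreover have "Liminf (at x) (\<lambda>y. ereal (m * \<bar>y - x0\<bar>)) \<le> Liminf (at x) I"
      by (intro Liminf_mono always_eventually) (auto simp: I_def)
    ultimately show ?thesis by simp
  next
    case False
    have "open (- {l..r})" by (intro open_Compl closed_atLeastAtMost)
    then have "eventually (\<lambda>y. y \<in> - {l..r}) (at x)"
      using False by (intro eventually_at_in_open') auto
    then have "eventually (\<lambda>y. \<infinity> \<le> I y) (at x)"
      by eventually_elim (auto simp: I_def)
    then have "\<infinity> \<le> Liminf (at x) I"
      by (rule Liminf_bounded)
    then show ?thesis by simp
  qed
qed

section \<open>From exponential bounds to limits of normalised logarithms\<close>

lemma Limsup_log_prob_le:
  assumes "\<And>t. 0 < t \<Longrightarrow> 0 \<le> P t" "\<And>t. 0 < t \<Longrightarrow> P t \<le> K * exp (- t * s)" and "0 < K"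
  shows "Limsup at_top (\<lambda>t::real. ereal (1 / t) * log_prob (P t)) \<le> ereal (- s)"
proof -
  \<comment> \<open>The prefactor contributes \<open>ln K / t\<close>, which vanishes in the
    limit.\<close>
  have "((\<lambda>t. ln K / t - s) \<longlongrightarrow> 0 - s) at_top"
    by (intro tendsto_diff tendsto_const real_tendsto_divide_at_top[OF tendsto_const filterlim_ident])
  then have lim: "((\<lambda>t. ereal (ln K / t - s)) \<longlongrightarrow> ereal (- s)) at_top"
    by simp
  have "Limsup at_top (\<lambda>t::real. ereal (1 / t) * log_prob (P t)) \<le>
      Limsup at_top (\<lambda>t. ereal (ln K / t - s))"
  proof (rule Limsup_mono)
    show "eventually (\<lambda>t. ereal (1 / t) * log_prob (P t) \<le> ereal (ln K / t - s)) at_top"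
      using eventually_gt_at_top[of 0]
    proof eventually_elim
      case (elim t)
      show ?case
      proof (cases "P t = 0")
        case True
        then show ?thesis using elim by (simp add: log_prob_def)
      next
        case False
        then have "0 < P t" using assms(1)[OF elim] by simp
        then have "ln (P t) \<le> ln (K * exp (- t * s))"
          using assms(2)[OF elim] by (intro ln_mono) auto
        also have "\<dots> = ln K - t * s"
          using \<open>0 < K\<close> by (simp add: ln_mult)
        finally have "ln (P t) / t \<le> (ln K - t * s) / t"
          using elim by (intro divide_right_mono) auto
        also have "\<dots> = ln K / t - s"
          using elim by (simp add: field_simps)
        finally show ?thesis using False by (simp add: log_prob_def)
      qed
    qed
  qed
  also have "\<dots> = ereal (- s)"
    by (rule lim_imp_Limsup[OF _ lim]) simp
  finally show ?thesis .
qed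

lemma Liminf_log_prob_ge:
  assumes "eventually (\<lambda>t. K * exp (- t * s) \<le> P t) at_top" and "0 < K"
  shows "ereal (- s) \<le> Liminf at_top (\<lambda>t::real. ereal (1 / t) * log_prob (P t))"
proof -
  have "((\<lambda>t. ln K / t - s) \<longlongrightarrow> 0 - s) at_top"
    by (intro tendsto_diff tendsto_const real_tendsto_divide_at_top[OF tendsto_const filterlim_ident])
  then have lim: "((\<lambda>t. ereal (ln K / t - s)) \<longlongrightarrow> ereal (- s)) at_top"
    by simp
  have "ereal (- s) = Liminf at_top (\<lambda>t. ereal (ln K / t - s))"
    by (rule lim_imp_Liminf[OF _ lim, symmetric]) simp
  also have "\<dots> \<le> Liminf at_top (\<lambda>t::real. ereal (1 / t) * log_prob (P t))"
  proof (rule Liminf_mono)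
    show "eventually (\<lambda>t. ereal (ln K / t - s) \<le> ereal (1 / t) * log_prob (P t)) at_top"
      using eventually_gt_at_top[of 0] assms(1)
    proof eventually_elim
      case (elim t)
      \<comment> \<open>The positive minorant forces \<open>P t > 0\<close>, so
        \<open>log_prob\<close> is the real logarithm here.\<close>
      have pos: "0 < K * exp (- t * s)" using \<open>0 < K\<close> by simp
      have "ln K / t - s = (ln K - t * s) / t"
        using elim by (simp add: field_simps)
      also have "ln K - t * s = ln (K * exp (- t * s))"
        using \<open>0 < K\<close> by (simp add: ln_mult)
      also have "\<dots> / t \<le> ln (P t) / t"
        using elim pos by (intro divide_right_mono ln_mono) auto
      finally show ?case using elim pos by (simp add: log_prob_def)
    qed
  qed
  finally show ?thesis .
qed

text \<open>For a window \<open>{y..z}\<close> inside \<open>G\<close> and close to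
  \<open>x\<close>, the probability of \<open>G\<close> is at least that of
  \<open>y \<le> Z t\<close> minus that of \<open>z < Z t\<close>. The subtracted tail decays at a
  strictly larger rate, so the cost is about \<open>m * (x - x0)\<close>.\<close>

lemma (in prob_space) Liminf_log_prob_open_right:
  fixes Z :: "real \<Rightarrow> 'a \<Rightarrow> real"
  assumes Z [measurable]: "\<And>t. 0 < t \<Longrightarrow> Z t \<in> borel_measurable M"
    and G: "open G" "x \<in> G" and x: "x0 \<le> x" "x \<le> r" "x0 < r" and m: "0 < m"
    and upper: "\<And>t y. 0 < t \<Longrightarrow> x0 < y \<Longrightarrow> y < r \<Longrightarrow>
      prob {\<omega> \<in> space M. y < Z t \<omega>} \<le> exp (- t * (m * (y - x0)))"
    and lower: "\<And>y. x0 < y \<Longrightarrow> y < r \<Longrightarrow> \<exists>\<kappa>>0. \<forall>t>0.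
      (1 - exp (- t * \<kappa>)) / (1 + exp (t * (m * (y - x0)))) \<le> prob {\<omega> \<in> space M. y \<le> Z t \<omega>}"
  shows "ereal (- (m * (x - x0))) \<le>
    Liminf at_top (\<lambda>t. ereal (1 / t) * log_prob (prob {\<omega> \<in> space M. Z t \<omega> \<in> G}))"
proof (rule ereal_le_epsilon2)
  fix e :: real assume e: "0 < e"
  obtain d where d: "0 < d" "ball x d \<subseteq> G"
    using G open_contains_ball by blast
  \<comment> \<open>\<open>d\<close> keeps the window inside \<open>G\<close>, and
    \<open>e / m\<close> keeps the additional cost \<open>m * h\<close> below
    \<open>e\<close>.\<close>
  define h where "h = min (e / m) d"
  have h: "0 < h" "h \<le> d" "m * h \<le> e"
    using e m d by (auto simp: h_def min_def field_simps)
  \<comment> \<open>The tail hypotheses hold strictly between \<open>x0\<close> and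
    \<open>r\<close>: the window lies to the right of \<open>x\<close>, except at
    \<open>x = r\<close>, where it must lie to the left.\<close>
  obtain y z where yz: "x0 < y" "y < z" "z < r" "y < x + h" "{y..z} \<subseteq> G"
  proof (cases "x < r")
    case True
    define k where "k = min h (r - x)"
    have "0 < k" "k \<le> h" "x + k \<le> r" using True h by (auto simp: k_def)
    then show ?thesis
      using x d h by (intro that[of "x + k / 3" "x + k / 2"]) (auto simp: dist_real_def subset_iff)
  next
    case False
    define k where "k = min h (r - x0)"
    have "0 < k" "k \<le> h" "x0 + k \<le> x" "x = r" using False x h by (auto simp: k_def)
    then show ?thesis
      using x d h by (intro that[of "x - k / 2" "x - k / 3"]) (auto simp: dist_real_def subset_iff)
  qed
  define J where "J y = m * (y - x0)" for y
  have J: "0 < J y" "J y < J z" "J y \<le> J x + e"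
  proof -
    show "0 < J y" "J y < J z" using yz m by (auto simp: J_def)
    have "J y \<le> m * (x + h - x0)" unfolding J_def using yz m by (intro mult_left_mono) auto
    also have "\<dots> = J x + m * h" by (simp add: J_def algebra_simps)
    finally show "J y \<le> J x + e" using h by simp
  qed
  obtain \<kappa> where \<kappa>: "0 < \<kappa>" "\<And>t. 0 < t \<Longrightarrow>
      (1 - exp (- t * \<kappa>)) / (1 + exp (t * J y)) \<le> prob {\<omega> \<in> space M. y \<le> Z t \<omega>}"
    using lower[of y] yz by (auto simp: J_def)
  have decay: "((\<lambda>t::real. exp (- t * c)) \<longlongrightarrow> 0) at_top" if "0 < c" for c :: real
    using that by real_asymp
  \<comment> \<open>The limit is 1/2, so 1/4 is a safe constant.\<close>
  have "((\<lambda>t. (1 - exp (- t * \<kappa>)) / 2 - exp (- t * (J z - J y))) \<longlongrightarrow> (1 - 0) / 2 - 0) at_top"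
    by (intro tendsto_diff tendsto_divide tendsto_const decay) (use \<kappa>(1) J in auto)
  then have "eventually (\<lambda>t. 1 / 4 < (1 - exp (- t * \<kappa>)) / 2 - exp (- t * (J z - J y))) at_top"
    by (rule order_tendstoD) simp
  then have "eventually (\<lambda>t. 1 / 4 * exp (- t * J y) \<le> prob {\<omega> \<in> space M. Z t \<omega> \<in> G}) at_top"
    using eventually_gt_at_top[of 0]
  proof eventually_elim
    case (elim t)
    note [measurable] = Z[OF elim(2)]
    have "G \<in> sets borel" using G by simp
    note [measurable] = this
    have "1 / 4 * exp (- t * J y) \<le>
        ((1 - exp (- t * \<kappa>)) / 2 - exp (- t * (J z - J y))) * exp (- t * J y)"
      using elim by (intro mult_right_mono) auto
    moreover have "((1 - exp (- t * \<kappa>)) / 2 - exp (- t * (J z - J y))) * exp (- t * J y) =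
        (1 - exp (- t * \<kappa>)) / 2 * exp (- t * J y) - exp (- t * (J z - J y)) * exp (- t * J y)"
      by (rule left_diff_distrib)
    moreover have "exp (- t * (J z - J y)) * exp (- t * J y) = exp (- t * J z)"
    proof -
      have "- t * (J z - J y) + - t * J y = - t * J z" by (simp add: algebra_simps)
      then show ?thesis by (simp only: exp_add[symmetric])
    qed
    moreover have "(1 - exp (- t * \<kappa>)) / 2 * exp (- t * J y) =
        (1 - exp (- t * \<kappa>)) / (2 * exp (t * J y))"
    proof -
      have "exp (- t * J y) = inverse (exp (t * J y))"
        using exp_minus[of "t * J y"] by simp
      then show ?thesis
        by (simp only: divide_inverse inverse_mult_distrib mult.assoc)
    qed
    \<comment> \<open>Since \<open>J y > 0\<close>, the denominator \<open>1 + exp (t * J y)\<close>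
      is at most \<open>2 * exp (t * J y)\<close>.\<close>
    moreover have "(1 - exp (- t * \<kappa>)) / (2 * exp (t * J y)) \<le>
        (1 - exp (- t * \<kappa>)) / (1 + exp (t * J y))"
      using elim J \<kappa> by (intro divide_left_mono mult_pos_pos add_pos_pos) auto
    moreover have "\<dots> \<le> prob {\<omega> \<in> space M. y \<le> Z t \<omega>}"
      by (rule \<kappa>(2)) fact
    moreover have "prob {\<omega> \<in> space M. z < Z t \<omega>} \<le> exp (- t * J z)"
      using upper[of t z] elim yz by (simp add: J_def)
    moreover have "prob {\<omega> \<in> space M. y \<le> Z t \<omega>} - prob {\<omega> \<in> space M. z < Z t \<omega>} =
        prob ({\<omega> \<in> space M. y \<le> Z t \<omega>} - {\<omega> \<in> space M. z < Z t \<omega>})"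
      using yz by (intro finite_measure_Diff[symmetric]) auto
    moreover have "\<dots> \<le> prob {\<omega> \<in> space M. Z t \<omega> \<in> G}"
      using yz(5) by (intro finite_measure_mono) (auto simp: subset_iff not_less)
    ultimately show ?case by linarith
  qed
  from Liminf_log_prob_ge[OF this] have
    "ereal (- J y) \<le> Liminf at_top (\<lambda>t. ereal (1 / t) * log_prob (prob {\<omega> \<in> space M. Z t \<omega> \<in> G}))"
    by simp
  moreover have "ereal (- J x) \<le> ereal (- J y) + ereal e"
    using J by simp
  ultimately show "ereal (- (m * (x - x0))) \<le>
      Liminf at_top (\<lambda>t. ereal (1 / t) * log_prob (prob {\<omega> \<in> space M. Z t \<omega> \<in> G})) + ereal e"
    unfolding J_def[symmetric] using add_right_mono order_trans by blast
qed

text \<open>\<open>I\<close> grows in both directions from \<open>x0\<close>, so a closed set on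
  which it exceeds \<open>s\<close> meets the range of \<open>Z t\<close> only in two tails. Open
  sets are treated pointwise, the left half by reflection.\<close>

lemma (in prob_space) LDP_abs_affine:
  fixes Z :: "real \<Rightarrow> 'a \<Rightarrow> real" and x0 m l r :: real
  assumes Z: "\<And>t. 0 < t \<Longrightarrow> Z t \<in> borel_measurable M"
    and lr: "l < x0" "x0 < r" and m: "0 < m"
    and range: "\<And>t. 0 < t \<Longrightarrow> AE \<omega> in M. Z t \<omega> \<in> {l..r}"
    and upper_right: "\<And>t y. 0 < t \<Longrightarrow> x0 < y \<Longrightarrow> y < r \<Longrightarrow>
      prob {\<omega> \<in> space M. y < Z t \<omega>} \<le> exp (- t * (m * (y - x0)))"
    and upper_left: "\<And>t y. 0 < t \<Longrightarrow> l < y \<Longrightarrow> y < x0 \<Longrightarrow>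
      prob {\<omega> \<in> space M. Z t \<omega> < y} \<le> exp (- t * (m * (x0 - y)))"
    and lower_right: "\<And>y. x0 < y \<Longrightarrow> y < r \<Longrightarrow> \<exists>\<kappa>>0. \<forall>t>0.
      (1 - exp (- t * \<kappa>)) / (1 + exp (t * (m * (y - x0)))) \<le> prob {\<omega> \<in> space M. y \<le> Z t \<omega>}"
    and lower_left: "\<And>y. l < y \<Longrightarrow> y < x0 \<Longrightarrow> \<exists>\<kappa>>0. \<forall>t>0.
      (1 - exp (- t * \<kappa>)) / (1 + exp (t * (m * (x0 - y)))) \<le> prob {\<omega> \<in> space M. Z t \<omega> \<le> y}"
  defines "I \<equiv> \<lambda>x. if x \<in> {l..r} then ereal (m * \<bar>x - x0\<bar>) else \<infinity>"
  shows "LDP M Z I"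
  unfolding LDP_def
proof (intro conjI allI impI)
  show "Z t \<in> borel_measurable M" if "0 < t" for t by (rule Z) fact
  show "0 \<le> I x" for x using m by (simp add: I_def)
  show "lower_semicontinuous I" unfolding I_def by (rule lower_semicontinuous_abs_affine)
next
  fix C :: "real set" assume C: "closed C"
  \<comment> \<open>From \<open>r\<close> on the tail is null by \<open>range\<close>. The extension
    matters because \<open>x0 + s / m\<close> below may exceed \<open>r\<close>.\<close>
  have tail_right: "prob {\<omega> \<in> space M. y < Z t \<omega>} \<le> exp (- t * (m * (y - x0)))"
    if "0 < t" "x0 < y" for t y
  proof (cases "y < r")
    case False
    have "AE \<omega> in M. \<omega> \<notin> {\<omega> \<in> space M. y < Z t \<omega>}"
      using range[OF that(1)] by (rule eventually_mono) (use False in auto)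
    then have "prob {\<omega> \<in> space M. y < Z t \<omega>} = 0"
      using Z[OF that(1)] by (intro prob_eq_0[THEN iffD2]) auto
    then show ?thesis by simp
  qed (use upper_right that in auto)
  have tail_left: "prob {\<omega> \<in> space M. Z t \<omega> < y} \<le> exp (- t * (m * (x0 - y)))"
    if "0 < t" "y < x0" for t y
  proof (cases "l < y")
    case False
    have "AE \<omega> in M. \<omega> \<notin> {\<omega> \<in> space M. Z t \<omega> < y}"
      using range[OF that(1)] by (rule eventually_mono) (use False in auto)
    then have "prob {\<omega> \<in> space M. Z t \<omega> < y} = 0"
      using Z[OF that(1)] by (intro prob_eq_0[THEN iffD2]) auto
    then show ?thesis by simp
  qed (use upper_left that in auto)
  \<comment> \<open>A finite \<open>s\<close> below the infimum is used because the infimum may be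
    infinite. Within \<open>{l..r}\<close> the set \<open>C\<close> stays farther than
    \<open>s / m\<close> from \<open>x0\<close>; \<open>K = 2\<close> counts the two tails.\<close>
  have bound: "Limsup at_top (\<lambda>t. ereal (1 / t) * log_prob (prob {\<omega> \<in> space M. Z t \<omega> \<in> C}))
      \<le> ereal (- s)" if s: "0 < s" "ereal s < (INF x\<in>C. I x)" for s
  proof (rule Limsup_log_prob_le[where K = 2])
    fix t :: real assume t: "0 < t"
    note [measurable] = Z[OF t]
    have far: "s < m * \<bar>x - x0\<bar>" if "x \<in> C" "x \<in> {l..r}" for x
      using order_less_le_trans[OF s(2) INF_lower[OF that(1)]] that(2) by (simp add: I_def)
    have "prob {\<omega> \<in> space M. Z t \<omega> \<in> C} \<le>
      prob ({\<omega> \<in> space M. x0 + s / m < Z t \<omega>} \<union> {\<omega> \<in> space M. Z t \<omega> < x0 - s / m})"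
    proof (rule finite_measure_mono_AE)
      show "AE \<omega> in M. \<omega> \<in> {\<omega> \<in> space M. Z t \<omega> \<in> C} \<longrightarrow>
          \<omega> \<in> {\<omega> \<in> space M. x0 + s / m < Z t \<omega>} \<union> {\<omega> \<in> space M. Z t \<omega> < x0 - s / m}"
        using range[OF t]
      proof eventually_elim
        case (elim \<omega>)
        then show ?case
          using far[of "Z t \<omega>"] m by (auto simp: field_simps abs_if split: if_splits)
      qed
    qed measurable
    also have "\<dots> \<le> prob {\<omega> \<in> space M. x0 + s / m < Z t \<omega>} + prob {\<omega> \<in> space M. Z t \<omega> < x0 - s / m}"
      by (rule measure_Un_le) measurable
    also have "\<dots> \<le> 2 * exp (- t * s)"
      using tail_right[OF t, of "x0 + s / m"] tail_left[OF t, of "x0 - s / m"] s m by simp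
    finally show "prob {\<omega> \<in> space M. Z t \<omega> \<in> C} \<le> 2 * exp (- t * s)" .
  qed auto
  show "Limsup at_top (\<lambda>t. ereal (1 / t) * log_prob (prob {\<omega> \<in> space M. Z t \<omega> \<in> C}))
      \<le> - (INF x\<in>C. I x)"
  proof (cases "(INF x\<in>C. I x) \<le> 0")
    case True
    \<comment> \<open>Here the trivial bound of a probability by 1 suffices.\<close>
    have "Limsup at_top (\<lambda>t. ereal (1 / t) * log_prob (prob {\<omega> \<in> space M. Z t \<omega> \<in> C})) \<le> ereal (- 0)"
      by (rule Limsup_log_prob_le[where K = 1]) auto
    also have "\<dots> \<le> - (INF x\<in>C. I x)"
      using True by (metis ereal_minus_le_minus ereal_uminus_zero minus_zero zero_ereal_def)
    finally show ?thesis .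
  next
    case False
    have swap: "a \<le> - b \<longleftrightarrow> b \<le> - a" for a b :: ereal
      by (metis ereal_minus_le_minus ereal_uminus_uminus)
    show ?thesis
    proof (subst swap, rule dense_le_bounded[of 0])
      show "0 < (INF x\<in>C. I x)" using False by simp
      fix w assume w: "0 < w" "w < (INF x\<in>C. I x)"
      then obtain s where "w = ereal s" "0 < s" by (cases w) auto
      with bound[of s] w show "w \<le> - Limsup at_top
          (\<lambda>t. ereal (1 / t) * log_prob (prob {\<omega> \<in> space M. Z t \<omega> \<in> C}))"
        by (simp add: swap[of "ereal s"])
    qed
  qed
next
  fix G :: "real set" assume G: "open G"
  have *: "- I x \<le> Liminf at_top (\<lambda>t. ereal (1 / t) * log_prob (prob {\<omega> \<in> space M. Z t \<omega> \<in> G}))"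
    if "x \<in> G" for x
  proof (cases "x \<in> {l..r}")
    case True
    show ?thesis
    proof (cases "x0 \<le> x")
      case right: True
      have "ereal (- (m * (x - x0))) \<le>
          Liminf at_top (\<lambda>t. ereal (1 / t) * log_prob (prob {\<omega> \<in> space M. Z t \<omega> \<in> G}))"
        using right True lr that m G Z upper_right lower_right
        by (intro Liminf_log_prob_open_right[where r = r]) auto
      then show ?thesis using True right by (simp add: I_def)
    next
      case left: False
      have "ereal (- (m * (- x - - x0))) \<le>
          Liminf at_top (\<lambda>t. ereal (1 / t) * log_prob (prob {\<omega> \<in> space M. - Z t \<omega> \<in> uminus ` G}))"
      proof (rule Liminf_log_prob_open_right[where r = "- l"])
        show "(\<lambda>\<omega>. - Z t \<omega>) \<in> borel_measurable M" if "0 < t" for t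
          using Z[OF that] by simp
        show "open (uminus ` G)" using G by (rule open_negations)
        show "prob {\<omega> \<in> space M. y < - Z t \<omega>} \<le> exp (- t * (m * (y - - x0)))"
          if "0 < t" "- x0 < y" "y < - l" for t y
          using upper_left[of t "- y"] that by (simp add: less_minus_iff add.commute)
        show "\<exists>\<kappa>>0. \<forall>t>0. (1 - exp (- t * \<kappa>)) / (1 + exp (t * (m * (y - - x0)))) \<le>
            prob {\<omega> \<in> space M. y \<le> - Z t \<omega>}" if "- x0 < y" "y < - l" for y
          using lower_left[of "- y"] that by (simp add: le_minus_iff add.commute)
      qed (use left True lr that m in auto)
      moreover have "- Z t \<omega> \<in> uminus ` G \<longleftrightarrow> Z t \<omega> \<in> G" for t \<omega> by auto
      ultimately show ?thesis using True left by (simp add: I_def abs_if)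
    qed
  next
    case False
    then have "I x = \<infinity>" unfolding I_def by (rule if_not_P)
    then show ?thesis by simp
  qed
  show "- (INF x\<in>G. I x) \<le>
      Liminf at_top (\<lambda>t. ereal (1 / t) * log_prob (prob {\<omega> \<in> space M. Z t \<omega> \<in> G}))"
  proof (subst ereal_uminus_le_reorder, rule INF_greatest)
    fix x assume "x \<in> G"
    from *[OF this] show "- Liminf at_top
        (\<lambda>t. ereal (1 / t) * log_prob (prob {\<omega> \<in> space M. Z t \<omega> \<in> G})) \<le> I x"
      by (subst ereal_uminus_le_reorder)
  qed
qed

section \<open>The damped telegraph process\<close>

text \<open>The complement of the first tail has bound \<open>q * (1 - p) / (p + q - p * q)\<close>.
  Giving away the factor \<open>1 - p\<close> makes the two bounds symmetric under exchanging
  \<open>p\<close> and \<open>q\<close>, as the mirrored initial velocity requires.\<close>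

lemma (in prob_space) even_time_two_sided_tail:
  assumes "0 < a" "0 < b" "damped_holding_times M a b \<tau>"
    and \<tau>: "\<And>n. n \<ge> 1 \<Longrightarrow> \<tau> n \<in> borel_measurable M"
    and "0 \<le> u" "u \<le> t"
  defines "p \<equiv> exp (- a * u)" and "q \<equiv> exp (- b * (t - u))"
  shows "prob {\<omega> \<in> space M. u < even_time \<tau> t \<omega>} \<le> p / (p + q - p * q)"
    and "prob {\<omega> \<in> space M. even_time \<tau> t \<omega> < u} \<le> q / (p + q - p * q)"
proof -
  note tail = even_time_tail[OF assms(1-6), folded p_def q_def]
  show "prob {\<omega> \<in> space M. u < even_time \<tau> t \<omega>} \<le> p / (p + q - p * q)"
    by (rule tail)
  have [measurable]: "even_time \<tau> t \<in> borel_measurable M"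
    by (intro even_time_measurable \<tau>)
  have pq: "0 < p" "0 < q" "q \<le> 1"
    using assms(2,6) by (auto simp: p_def q_def)
  have "p * q \<le> p * 1" using pq by (intro mult_left_mono) auto
  with pq have d: "0 < p + q - p * q" by linarith
  then have "1 - p / (p + q - p * q) = (q - p * q) / (p + q - p * q)"
    by (simp add: field_simps)
  also have "\<dots> \<le> q / (p + q - p * q)"
    using pq d by (intro divide_right_mono) auto
  finally have "1 - p / (p + q - p * q) \<le> q / (p + q - p * q)" .
  moreover have "{\<omega> \<in> space M. even_time \<tau> t \<omega> < u} = space M - {\<omega> \<in> space M. u \<le> even_time \<tau> t \<omega>}"
    by auto
  then have "prob {\<omega> \<in> space M. even_time \<tau> t \<omega> < u} = 1 - prob {\<omega> \<in> space M. u \<le> even_time \<tau> t \<omega>}"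
    by (simp add: prob_compl)
  ultimately show "prob {\<omega> \<in> space M. even_time \<tau> t \<omega> < u} \<le> q / (p + q - p * q)"
    using tail(2) by linarith
qed

text \<open>Total probability: an average of two quantities bounded by the same \<open>c\<close> is
  bounded by \<open>c\<close>, whatever the weights.\<close>

lemma (in prob_space) prob_le_of_conditional_le:
  assumes AB: "A \<in> events" "B \<in> events" "A \<inter> B = {}" "prob A + prob B = 1" and E: "E \<in> events"
    and A: "0 < prob A \<Longrightarrow> measure (uniform_measure M A) E \<le> c"
    and B: "0 < prob B \<Longrightarrow> measure (uniform_measure M B) E \<le> c"
  shows "prob E \<le> c"
proof -
  have cond: "prob (X \<inter> E) \<le> prob X * c"
    if "X \<in> events" "0 < prob X \<Longrightarrow> measure (uniform_measure M X) E \<le> c" for X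
  proof (cases "prob X = 0")
    \<comment> \<open>Conditioning is meaningless here, but a null event contributes
      nothing.\<close>
    case True
    moreover have "prob (X \<inter> E) \<le> prob X"
      using that(1) by (intro finite_measure_mono) auto
    ultimately show ?thesis by simp
  next
    case False
    then have "0 < prob X" using measure_nonneg[of M X] by linarith
    have "measure (uniform_measure M X) E = prob (X \<inter> E) / prob X"
      using E \<open>0 < prob X\<close> by (intro measure_uniform_measure) (auto simp: emeasure_eq_measure)
    with that(2)[OF \<open>0 < prob X\<close>] have "prob (X \<inter> E) / prob X \<le> c" by simp
    then show ?thesis using \<open>0 < prob X\<close> by (simp add: field_simps)
  qed
  have "prob (A \<union> B) = 1"
    using AB finite_measure_Union[of A B] by simp
  then have "AE \<omega> in M. \<omega> \<in> A \<union> B"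
    using AB by (subst (asm) prob_eq_1) auto
  then have "prob E = prob ((A \<inter> E) \<union> (B \<inter> E))"
    using AB E by (intro measure_eq_AE) auto
  also have "\<dots> = prob (A \<inter> E) + prob (B \<inter> E)"
    using AB E by (intro finite_measure_Union) auto
  also have "\<dots> \<le> prob A * c + prob B * c"
    using cond[OF AB(1) A] cond[OF AB(2) B] by linarith
  also have "\<dots> = c"
    using AB(4) by (simp add: distrib_right[symmetric])
  finally show ?thesis .
qed

text \<open>\<open>Z\<close> is an increasing affine function of the occupation time given
  \<open>c1\<close>, a decreasing one given \<open>- c2\<close>. The second case exchanges
  \<open>u\<close> with \<open>t - u\<close>, the two rates, and the two tails, so both conditional
  bounds coincide.\<close>

lemma (in damped_telegraph) position_tails:
  assumes lam: "0 < lam1" "0 < lam2" and c: "0 < c1" "0 < c2"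
    and t: "0 < t" and y: "- c2 < y" "y < c1"
  defines "Z \<equiv> \<lambda>\<omega>. telegraph_position c1 c2 V0 \<tau> t \<omega> / t"
    and "p \<equiv> exp (- t * (lam1 * (y + c2) / (c1 + c2)))"
    and "q \<equiv> exp (- t * (lam2 * (c1 - y) / (c1 + c2)))"
  shows "Z \<in> borel_measurable M"
    and "prob {\<omega> \<in> space M. y < Z \<omega>} \<le> p / (p + q - p * q)"
    and "prob {\<omega> \<in> space M. Z \<omega> < y} \<le> q / (p + q - p * q)"
proof -
  note [measurable] = V0_measurable
  define S where "S = c1 + c2"
  define A where "A = {\<omega> \<in> space M. V0 \<omega> = c1}"
  define B where "B = {\<omega> \<in> space M. V0 \<omega> = - c2}"
  \<comment> \<open>Upward time that yields average velocity \<open>y\<close>: it solves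
    \<open>S * u - c2 * t = y * t\<close>.\<close>
  define u where "u = (y + c2) / S * t"
  have S: "0 < S" using c by (simp add: S_def)
  have "(y + c2) / S < 1" using S y by (simp add: S_def)
  then have u: "0 < u" "u < t"
    using S t y mult_strict_right_mono[of "(y + c2) / S" 1 t] by (auto simp: u_def)
  have tu: "t - u = (c1 - y) / S * t"
    using S by (simp add: u_def S_def field_simps)
  have Su: "S / t * u = y + c2" and Stu: "S / t * (t - u) = c1 - y"
    unfolding tu using S t by (simp_all add: u_def)
  have p: "p = exp (- lam1 * u)" and q: "q = exp (- lam2 * (t - u))"
    unfolding tu by (simp_all add: p_def q_def u_def S_def)
  have [measurable]: "A \<in> events" "B \<in> events"
    unfolding A_def B_def by measurable
  have AB: "A \<inter> B = {}" "prob A = \<alpha>" "prob B = 1 - \<alpha>"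
    using V0_pos V0_neg c by (auto simp: A_def B_def)
  have E [measurable]: "even_time \<tau> t \<in> borel_measurable M"
    by (intro even_time_measurable \<tau>_measurable)
  have pos: "telegraph_position c1 c2 V0 \<tau> t \<omega> =
      t * ((c1 - c2) / 2) + (c1 + c2) / 2 * (of_bool (V0 \<omega> = c1) - of_bool (V0 \<omega> = - c2)) *
        (2 * even_time \<tau> t \<omega> - t)" if "\<omega> \<in> space M" for \<omega>
    using t by (intro telegraph_position_eq[OF that \<tau>_measurable]) auto
  have "(\<lambda>\<omega>. t * ((c1 - c2) / 2) + (c1 + c2) / 2 * (of_bool (V0 \<omega> = c1) - of_bool (V0 \<omega> = - c2)) *
      (2 * even_time \<tau> t \<omega> - t)) \<in> borel_measurable M"
    by measurable
  then have "telegraph_position c1 c2 V0 \<tau> t \<in> borel_measurable M"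
    by (subst measurable_cong[OF pos])
  then show Z [measurable]: "Z \<in> borel_measurable M"
    unfolding Z_def by measurable
  have ZA: "y < Z \<omega> \<longleftrightarrow> u < even_time \<tau> t \<omega>" "Z \<omega> < y \<longleftrightarrow> even_time \<tau> t \<omega> < u" if "\<omega> \<in> A" for \<omega>
  proof -
    have "telegraph_position c1 c2 V0 \<tau> t \<omega> = S * even_time \<tau> t \<omega> - c2 * t"
      using that c pos[of \<omega>] by (simp add: A_def S_def field_simps)
    then have "Z \<omega> = S / t * even_time \<tau> t \<omega> - c2"
      using t by (simp add: Z_def diff_divide_distrib)
    then have "Z \<omega> - y = S / t * (even_time \<tau> t \<omega> - u)"
      unfolding right_diff_distrib Su by simp
    moreover have "0 < S / t" using S t by simp
    ultimately show "y < Z \<omega> \<longleftrightarrow> u < even_time \<tau> t \<omega>" "Z \<omega> < y \<longleftrightarrow> even_time \<tau> t \<omega> < u"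
      using zero_less_mult_iff[of "S / t" "even_time \<tau> t \<omega> - u"]
        mult_less_0_iff[of "S / t" "even_time \<tau> t \<omega> - u"] by auto
  qed
  have ZB: "y < Z \<omega> \<longleftrightarrow> even_time \<tau> t \<omega> < t - u" "Z \<omega> < y \<longleftrightarrow> t - u < even_time \<tau> t \<omega>"
    if "\<omega> \<in> B" for \<omega>
  proof -
    have "telegraph_position c1 c2 V0 \<tau> t \<omega> = c1 * t - S * even_time \<tau> t \<omega>"
      using that c pos[of \<omega>] by (simp add: B_def S_def field_simps)
    then have "Z \<omega> = c1 - S / t * even_time \<tau> t \<omega>"
      using t by (simp add: Z_def diff_divide_distrib)
    then have "Z \<omega> - y = S / t * (t - u - even_time \<tau> t \<omega>)"
      unfolding right_diff_distrib[of _ "t - u"] Stu by simp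
    moreover have "0 < S / t" using S t by simp
    ultimately show "y < Z \<omega> \<longleftrightarrow> even_time \<tau> t \<omega> < t - u" "Z \<omega> < y \<longleftrightarrow> t - u < even_time \<tau> t \<omega>"
      using zero_less_mult_iff[of "S / t" "t - u - even_time \<tau> t \<omega>"]
        mult_less_0_iff[of "S / t" "t - u - even_time \<tau> t \<omega>"] by auto
  qed
  have QA: "measure (uniform_measure M A) {\<omega> \<in> space M. y < Z \<omega>} \<le> p / (p + q - p * q)"
    "measure (uniform_measure M A) {\<omega> \<in> space M. Z \<omega> < y} \<le> q / (p + q - p * q)" if "0 < prob A"
  proof -
    interpret Q: prob_space "uniform_measure M A"
      using that by (intro prob_space_uniform_measure) (auto simp: emeasure_eq_measure)
    have AE: "AE \<omega> in uniform_measure M A. \<omega> \<in> A"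
      by (intro AE_uniform_measureI) auto
    have "damped_holding_times (uniform_measure M A) lam1 lam2 \<tau>"
      using \<tau>_given_pos that AB by (simp add: A_def)
    note tails = Q.even_time_two_sided_tail[OF lam this _ less_imp_le[OF u(1)] less_imp_le[OF u(2)],
        folded p q]
    have "measure (uniform_measure M A) {\<omega> \<in> space M. y < Z \<omega>} =
        measure (uniform_measure M A) {\<omega> \<in> space M. u < even_time \<tau> t \<omega>}"
      by (rule Q.finite_measure_eq_AE) (use AE in \<open>auto elim!: eventually_mono simp: ZA\<close>)
    with tails(1) show "measure (uniform_measure M A) {\<omega> \<in> space M. y < Z \<omega>} \<le> p / (p + q - p * q)"
      using \<tau>_measurable by simp
    have "measure (uniform_measure M A) {\<omega> \<in> space M. Z \<omega> < y} =
        measure (uniform_measure M A) {\<omega> \<in> space M. even_time \<tau> t \<omega> < u}"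
      by (rule Q.finite_measure_eq_AE) (use AE in \<open>auto elim!: eventually_mono simp: ZA\<close>)
    with tails(2) show "measure (uniform_measure M A) {\<omega> \<in> space M. Z \<omega> < y} \<le> q / (p + q - p * q)"
      using \<tau>_measurable by simp
  qed
  have QB: "measure (uniform_measure M B) {\<omega> \<in> space M. y < Z \<omega>} \<le> p / (p + q - p * q)"
    "measure (uniform_measure M B) {\<omega> \<in> space M. Z \<omega> < y} \<le> q / (p + q - p * q)" if "0 < prob B"
  proof -
    interpret Q: prob_space "uniform_measure M B"
      using that by (intro prob_space_uniform_measure) (auto simp: emeasure_eq_measure)
    have AE: "AE \<omega> in uniform_measure M B. \<omega> \<in> B"
      by (intro AE_uniform_measureI) auto
    have hold: "damped_holding_times (uniform_measure M B) lam2 lam1 \<tau>"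
      using \<tau>_given_neg that AB by (simp add: B_def)
    have tails: "measure (uniform_measure M B) {\<omega> \<in> space M. t - u < even_time \<tau> t \<omega>} \<le> q / (p + q - p * q)"
      "measure (uniform_measure M B) {\<omega> \<in> space M. even_time \<tau> t \<omega> < t - u} \<le> p / (p + q - p * q)"
      \<comment> \<open>With threshold \<open>t - u\<close> and exchanged rates, the lemma's
        \<open>p\<close> is the present \<open>q\<close> and conversely.\<close>
      using Q.even_time_two_sided_tail[OF lam(2,1) hold, of "t - u" t] u \<tau>_measurable
      by (simp_all add: p q add.commute mult.commute)
    have "measure (uniform_measure M B) {\<omega> \<in> space M. y < Z \<omega>} =
        measure (uniform_measure M B) {\<omega> \<in> space M. even_time \<tau> t \<omega> < t - u}"
      by (rule Q.finite_measure_eq_AE) (use AE in \<open>auto elim!: eventually_mono simp: ZB\<close>)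
    with tails(2) show "measure (uniform_measure M B) {\<omega> \<in> space M. y < Z \<omega>} \<le> p / (p + q - p * q)"
      by simp
    have "measure (uniform_measure M B) {\<omega> \<in> space M. Z \<omega> < y} =
        measure (uniform_measure M B) {\<omega> \<in> space M. t - u < even_time \<tau> t \<omega>}"
      by (rule Q.finite_measure_eq_AE) (use AE in \<open>auto elim!: eventually_mono simp: ZB\<close>)
    with tails(1) show "measure (uniform_measure M B) {\<omega> \<in> space M. Z \<omega> < y} \<le> q / (p + q - p * q)"
      by simp
  qed
  show "prob {\<omega> \<in> space M. y < Z \<omega>} \<le> p / (p + q - p * q)"
    by (rule prob_le_of_conditional_le[of A B]) (use AB QA QB in auto)
  show "prob {\<omega> \<in> space M. Z \<omega> < y} \<le> q / (p + q - p * q)"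
    by (rule prob_le_of_conditional_le[of A B]) (use AB QA QB in auto)
qed

text \<open>The denominator lies between \<open>q\<close> and \<open>p + q\<close>. This replaces
  the exact expression by the ratio \<open>p / q\<close>, whose exponent is affine in
  \<open>y\<close>, in the shape that \<open>LDP_abs_affine\<close> expects.\<close>

lemma tail_ratio_bounds:
  fixes p q :: real
  assumes "0 < p" "p \<le> 1" "0 < q" "q \<le> 1"
  shows "p / (p + q - p * q) \<le> p / q"
    and "(1 - p) / (1 + p / q) \<le> 1 - p / (p + q - p * q)"
proof -
  have pq: "p * q \<le> p" "0 < p * q" using assms by (auto simp: mult_left_le)
  then have pos: "0 < p + q - p * q" using assms by linarith
  show "p / (p + q - p * q) \<le> p / q"
    using assms pq pos by (intro divide_left_mono) auto
  have "(1 - p) / (1 + p / q) = (q * (1 - p)) / (p + q)"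
    using assms by (simp add: field_simps)
  also have "\<dots> \<le> (q * (1 - p)) / (p + q - p * q)"
    using assms pq pos by (intro divide_left_mono mult_nonneg_nonneg) auto
  also have "\<dots> = 1 - p / (p + q - p * q)"
    using pos by (simp add: field_simps)
  finally show "(1 - p) / (1 + p / q) \<le> 1 - p / (p + q - p * q)" .
qed

theorem proposition4p1:
  fixes M :: "'a measure"
    and lam1 lam2 c1 c2 \<alpha> :: real
    and V0 :: "'a \<Rightarrow> real"
    and \<tau> :: "nat \<Rightarrow> 'a \<Rightarrow> real"
  assumes "lam1 > 0" "lam2 > 0" "c1 > 0" "c2 > 0" "\<alpha> \<in> {0..1}"
    and "damped_telegraph M lam1 lam2 c1 c2 \<alpha> V0 \<tau>"
  shows "LDP M (\<lambda>t \<omega>. telegraph_position c1 c2 V0 \<tau> t \<omega> / t) (damped_rate lam1 lam2 c1 c2) \<and>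
         good_rate (damped_rate lam1 lam2 c1 c2)"
proof -
  interpret damped_telegraph M lam1 lam2 c1 c2 \<alpha> V0 \<tau> by fact
  define Z where "Z t \<omega> = telegraph_position c1 c2 V0 \<tau> t \<omega> / t" for t \<omega>
  define m where "m = (lam1 + lam2) / (c1 + c2)"
  \<comment> \<open>The velocity at which \<open>P\<close> and \<open>Q\<close> coincide, and the
    zero of the rate function.\<close>
  define x0 where "x0 = (lam2 * c1 - lam1 * c2) / (lam1 + lam2)"
  define P where "P y t = exp (- t * (lam1 * (y + c2) / (c1 + c2)))" for y t
  define Q where "Q y t = exp (- t * (lam2 * (c1 - y) / (c1 + c2)))" for y t
  have m: "0 < m" using assms by (simp add: m_def)
  have "x0 + c2 = lam2 * (c1 + c2) / (lam1 + lam2)" "c1 - x0 = lam1 * (c1 + c2) / (lam1 + lam2)"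
    using assms by (simp_all add: x0_def field_simps)
  moreover have "0 < lam2 * (c1 + c2) / (lam1 + lam2)" "0 < lam1 * (c1 + c2) / (lam1 + lam2)"
    using assms by (auto intro!: divide_pos_pos mult_pos_pos)
  ultimately have x0: "- c2 < x0" "x0 < c1" by linarith+
  have mx: "m * (y - x0) = ((lam1 + lam2) * y - (lam2 * c1 - lam1 * c2)) / (c1 + c2)" for y
  proof -
    have "m * x0 = (lam2 * c1 - lam1 * c2) / (c1 + c2)"
      using assms by (simp add: m_def x0_def)
    then show ?thesis
      unfolding right_diff_distrib by (simp add: m_def diff_divide_distrib)
  qed
  have rate: "damped_rate lam1 lam2 c1 c2 =
      (\<lambda>x. if x \<in> {- c2..c1} then ereal (m * \<bar>x - x0\<bar>) else \<infinity>)"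
  proof
    fix x
    have "m * \<bar>x - x0\<bar> = \<bar>m * (x - x0)\<bar>" using m by (simp add: abs_mult)
    also have "\<dots> = \<bar>(lam1 + lam2) * x - (lam2 * c1 - lam1 * c2)\<bar> / (c1 + c2)"
      unfolding mx using assms by simp
    finally show "damped_rate lam1 lam2 c1 c2 x = (if x \<in> {- c2..c1} then ereal (m * \<bar>x - x0\<bar>) else \<infinity>)"
      by (simp add: damped_rate_def)
  qed
  note tails = position_tails[OF assms(1-4), folded Z_def P_def Q_def]
  \<comment> \<open>\<open>position_tails\<close> speaks of a velocity strictly between
    \<open>- c2\<close> and \<open>c1\<close>; \<open>x0\<close> serves as one.\<close>
  have Z [measurable]: "Z t \<in> borel_measurable M" if "0 < t" for t
    using tails(1)[OF that x0] unfolding Z_def by simp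
  have PQ: "0 < P y t" "P y t \<le> 1" "0 < Q y t" "Q y t \<le> 1" if "0 < t" "- c2 < y" "y < c1" for y t
    using that assms by (auto simp: P_def Q_def)
  \<comment> \<open>The exponents differ by \<open>lam1 * (y + c2) - lam2 * (c1 - y)\<close> over
    \<open>c1 + c2\<close>, which is \<open>m * (y - x0)\<close>.\<close>
  have PdivQ: "P y t / Q y t = exp (- t * (m * (y - x0)))" for y t
    unfolding P_def Q_def mx exp_diff[symmetric]
    by (rule arg_cong[where f = exp]) (simp add: field_simps diff_divide_distrib add_divide_distrib)
  have QdivP: "Q y t / P y t = exp (t * (m * (y - x0)))" for y t
  proof -
    have "Q y t / P y t = inverse (P y t / Q y t)" by simp
    then show ?thesis unfolding PdivQ exp_minus[symmetric] by simp
  qed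
  \<comment> \<open>\<open>Z\<close> is the midpoint of \<open>{- c2..c1}\<close> plus half its
    length times \<open>d * e\<close>, and both factors are at most 1 in modulus.\<close>
  have range: "Z t \<omega> \<in> {- c2..c1}" if "0 < t" "\<omega> \<in> space M" for t \<omega>
  proof -
    define d :: real where "d = of_bool (V0 \<omega> = c1) - of_bool (V0 \<omega> = - c2)"
    define e where "e = (2 * even_time \<tau> t \<omega> - t) / t"
    have "\<bar>e\<bar> \<le> 1"
      using even_time_bounds[where \<tau> = \<tau> and t = t, OF that(2) \<tau>_measurable] that(1)
      by (auto simp: e_def abs_le_iff field_simps)
    moreover have "\<bar>d\<bar> \<le> 1" by (auto simp: d_def)
    ultimately have "\<bar>d * e\<bar> \<le> 1 * 1"
      unfolding abs_mult by (intro mult_mono) auto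
    then have "\<bar>(c1 + c2) / 2 * (d * e)\<bar> \<le> (c1 + c2) / 2 * 1"
      using assms unfolding abs_mult by (intro mult_mono) auto
    moreover have "Z t \<omega> = (c1 - c2) / 2 + (c1 + c2) / 2 * (d * e)"
      unfolding Z_def d_def e_def
      using telegraph_position_eq[where \<tau> = \<tau> and t = t and ?V0.0 = V0 and ?c1.0 = c1 and ?c2.0 = c2, OF that(2) \<tau>_measurable] that(1)
      by (simp add: add_divide_distrib)
    ultimately show ?thesis by (auto simp: abs_le_iff field_simps)
  qed
  have compl: "prob {\<omega> \<in> space M. y \<le> Z t \<omega>} = 1 - prob {\<omega> \<in> space M. Z t \<omega> < y}"
    "prob {\<omega> \<in> space M. Z t \<omega> \<le> y} = 1 - prob {\<omega> \<in> space M. y < Z t \<omega>}" if "0 < t" for t y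
  proof -
    note [measurable] = Z[OF that]
    have "{\<omega> \<in> space M. y \<le> Z t \<omega>} = space M - {\<omega> \<in> space M. Z t \<omega> < y}"
      "{\<omega> \<in> space M. Z t \<omega> \<le> y} = space M - {\<omega> \<in> space M. y < Z t \<omega>}" by auto
    then show "prob {\<omega> \<in> space M. y \<le> Z t \<omega>} = 1 - prob {\<omega> \<in> space M. Z t \<omega> < y}"
      "prob {\<omega> \<in> space M. Z t \<omega> \<le> y} = 1 - prob {\<omega> \<in> space M. y < Z t \<omega>}"
      by (simp_all add: prob_compl)
  qed
  have "LDP M Z (damped_rate lam1 lam2 c1 c2)"
    unfolding rate
  proof (rule LDP_abs_affine[OF Z x0 m])
    show "AE \<omega> in M. Z t \<omega> \<in> {- c2..c1}" if "0 < t" for t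
      using range[OF that] by (intro AE_I2)
    fix y :: real
    {
      fix t :: real assume t: "0 < t" and y: "x0 < y" "y < c1"
      then have y': "- c2 < y" using x0 by linarith
      from tails(2)[OF t y' y(2)] tail_ratio_bounds(1)[OF PQ[OF t y' y(2)]]
      show "prob {\<omega> \<in> space M. y < Z t \<omega>} \<le> exp (- t * (m * (y - x0)))"
        unfolding PdivQ by (simp add: Z_def)
    }
    {
      fix t :: real assume t: "0 < t" and y: "- c2 < y" "y < x0"
      then have y': "y < c1" using x0 by linarith
      \<comment> \<open>Left tails use the ratio bounds with \<open>P\<close> and \<open>Q\<close>
        exchanged.\<close>
      have "prob {\<omega> \<in> space M. Z t \<omega> < y} \<le> Q y t / P y t"
        using tails(3)[OF t y(1) y'] tail_ratio_bounds(1)[of "Q y t" "P y t"] PQ[OF t y(1) y']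
        by (simp add: Z_def add.commute mult.commute)
      also have "\<dots> = exp (- t * (m * (x0 - y)))"
        unfolding QdivP by (rule arg_cong[where f = exp]) (simp add: algebra_simps)
      finally show "prob {\<omega> \<in> space M. Z t \<omega> < y} \<le> exp (- t * (m * (x0 - y)))" .
    }
    {
      assume y: "x0 < y" "y < c1"
      then have y': "- c2 < y" using x0 by linarith
      show "\<exists>\<kappa>>0. \<forall>t>0. (1 - exp (- t * \<kappa>)) / (1 + exp (t * (m * (y - x0)))) \<le>
          prob {\<omega> \<in> space M. y \<le> Z t \<omega>}"
      proof (intro exI conjI allI impI)
        \<comment> \<open>The witness is the decay rate of \<open>Q y t\<close>, since the
          complement of the left tail carries the factor \<open>1 - Q y t\<close>.\<close>
        show "0 < lam2 * (c1 - y) / (c1 + c2)" using assms y by simp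
        fix t :: real assume t: "0 < t"
        have "(1 - Q y t) / (1 + Q y t / P y t) \<le> 1 - Q y t / (Q y t + P y t - Q y t * P y t)"
          using PQ[OF t y' y(2)] by (intro tail_ratio_bounds)
        also have "\<dots> \<le> prob {\<omega> \<in> space M. y \<le> Z t \<omega>}"
          using tails(3)[OF t y' y(2)] unfolding compl[OF t] by (simp add: Z_def add.commute mult.commute)
        finally show "(1 - exp (- t * (lam2 * (c1 - y) / (c1 + c2)))) / (1 + exp (t * (m * (y - x0)))) \<le>
          prob {\<omega> \<in> space M. y \<le> Z t \<omega>}"
          unfolding QdivP by (simp only: Q_def)
      qed
    }
    {
      assume y: "- c2 < y" "y < x0"
      then have y': "y < c1" using x0 by linarith
      show "\<exists>\<kappa>>0. \<forall>t>0. (1 - exp (- t * \<kappa>)) / (1 + exp (t * (m * (x0 - y)))) \<le>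
          prob {\<omega> \<in> space M. Z t \<omega> \<le> y}"
      proof (intro exI conjI allI impI)
        show "0 < lam1 * (y + c2) / (c1 + c2)" using assms y by simp
        fix t :: real assume t: "0 < t"
        have "(1 - P y t) / (1 + P y t / Q y t) \<le> 1 - P y t / (P y t + Q y t - P y t * Q y t)"
          using PQ[OF t y(1) y'] by (intro tail_ratio_bounds)
        also have "\<dots> \<le> prob {\<omega> \<in> space M. Z t \<omega> \<le> y}"
          using tails(2)[OF t y(1) y'] unfolding compl[OF t] by (simp add: Z_def)
        also have "P y t / Q y t = exp (t * (m * (x0 - y)))"
          unfolding PdivQ by (rule arg_cong[where f = exp]) (simp add: algebra_simps)
        finally show "(1 - exp (- t * (lam1 * (y + c2) / (c1 + c2)))) / (1 + exp (t * (m * (x0 - y)))) \<le>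
          prob {\<omega> \<in> space M. Z t \<omega> \<le> y}"
          by (simp only: P_def)
      qed
    }
  qed
  moreover have "good_rate (damped_rate lam1 lam2 c1 c2)"
    unfolding rate by (rule good_rate_abs_affine)
  ultimately show ?thesis
    unfolding Z_def[abs_def] by simp
qed

end
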